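(* Let $G$ be a graph with no odd hole. Then $\chi(G)\le 2^{2^{\omega(G)+2}}$.
   Context: All graphs are finite and have no loops or parallel edges. A hole in a graph is an induced subgraph which is a cycle of length at least four; a hole is odd if its length (number of edges) is odd (so an odd hole is an induced cycle of odd length at least five). $\chi(G)$ denotes the chromatic number of $G$, and $\omega(G)$ denotes the cardinality of the largest clique of $G$, where a clique is a set of pairwise adjacent vertices. *)

theory Defs
  imports "Graph_Theory.Digraph_Component"
begin

text \<open>
  A finite simple graph is a \<^locale>\<open>graph\<close>: a finite symmetric digraph without loops and
  parallel arcs. Each undirected edge is a pair of opposite arcs, so adjacency of \<open>u\<close> and \<open>v\<close>
  is \<^prop>\<open>u \<rightarrow>\<^bsub>G\<^esub> v\<close>, and the number of edges is half the number of arcs.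
\<close>

text \<open>
  The constant \<open>pre_digraph.cycle\<close> of the library describes closed arc walks in a digraph
  (including \<open>u, v, u\<close> in a symmetric one). Here a cycle is a graph in its own right.
\<close>

definition cycle_graph :: "nat \<Rightarrow> ('a, 'b) pre_digraph \<Rightarrow> bool" where
  "cycle_graph n H \<longleftrightarrow> graph H \<and> 3 \<le> n \<and>
     (\<exists>c. bij_betw c {..<n} (verts H) \<and>
        (\<forall>i<n. \<forall>j<n. c i \<rightarrow>\<^bsub>H\<^esub> c j \<longleftrightarrow> j = Suc i mod n \<or> i = Suc j mod n))"

definition hole :: "('a, 'b) pre_digraph \<Rightarrow> nat \<Rightarrow> ('a, 'b) pre_digraph \<Rightarrow> bool" where
  "hole G n H \<longleftrightarrow> induced_subgraph H G \<and> 4 \<le> n \<and> cycle_graph n H"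

definition odd_hole :: "('a, 'b) pre_digraph \<Rightarrow> ('a, 'b) pre_digraph \<Rightarrow> bool" where
  "odd_hole G H \<longleftrightarrow> (\<exists>n. odd n \<and> hole G n H)"

definition clique :: "('a, 'b) pre_digraph \<Rightarrow> 'a set \<Rightarrow> bool" where
  "clique G K \<longleftrightarrow> K \<subseteq> verts G \<and> (\<forall>u\<in>K. \<forall>v\<in>K. u \<noteq> v \<longrightarrow> u \<rightarrow>\<^bsub>G\<^esub> v)"

definition clique_number :: "('a, 'b) pre_digraph \<Rightarrow> nat" where
  "clique_number G = Max (card ` {K. clique G K})"

definition proper_colouring :: "('a, 'b) pre_digraph \<Rightarrow> nat \<Rightarrow> ('a \<Rightarrow> nat) \<Rightarrow> bool" where
  "proper_colouring G k f \<longleftrightarrow> f ` verts G \<subseteq> {..<k} \<and> (\<forall>u v. u \<rightarrow>\<^bsub>G\<^esub> v \<longrightarrow> f u \<noteq> f v)"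

definition chromatic_number :: "('a, 'b) pre_digraph \<Rightarrow> nat" where
  "chromatic_number G = (LEAST k. \<exists>f. proper_colouring G k f)"

lemma (in graph) finite_cliques: "finite {K. clique G K}"
  by (rule finite_subset[of _ "Pow (verts G)"]) (auto simp: clique_def)

lemma (in graph) clique_card_le: "clique G K \<Longrightarrow> card K \<le> clique_number G"
  unfolding clique_number_def by (rule Max_ge) (use finite_cliques in auto)

lemma (in graph) clique_number_attained: "\<exists>K. clique G K \<and> card K = clique_number G"
proof -
  have "clique G {}" by (simp add: clique_def)
  then have "Max (card ` {K. clique G K}) \<in> card ` {K. clique G K}"
    by (intro Max_in) (use finite_cliques in auto)
  then show ?thesis by (auto simp: clique_number_def)
qed

lemma chromatic_number_le: "proper_colouring G k f \<Longrightarrow> chromatic_number G \<le> k"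
  unfolding chromatic_number_def by (rule Least_le) blast

lemma (in graph) chromatic_number_attained: "\<exists>f. proper_colouring G (chromatic_number G) f"
proof -
  obtain f :: "'a \<Rightarrow> nat" and n where f: "f ` verts G = {i. i < n}" "inj_on f (verts G)"
    using finite_imp_inj_to_nat_seg[OF finite_verts] by blast
  have "f u \<noteq> f v" if uv: "u \<rightarrow> v" for u v
  proof
    assume "f u = f v"
    moreover have "u \<in> verts G" "v \<in> verts G"
      using uv adj_in_verts by blast+
    ultimately have "u = v"
      using f(2) by (blast dest: inj_onD)
    then show False using uv adj_not_same by blast
  qed
  then have "proper_colouring G n f"
    using f(1) unfolding proper_colouring_def by blast
  then have "\<exists>k f. proper_colouring G k f"
    by blast
  then show ?thesis
    unfolding chromatic_number_def by (rule LeastI_ex)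
qed

end

theory Submission
  imports Defs
begin

text \<open>
  The proof is by induction on the clique number \<open>w\<close>, with \<open>n\<close> colours for clique number \<open>w - 1\<close>.
  Two induced paths with the same
  nonadjacent ends and disjoint, mutually anticomplete interiors have lengths of the same parity, since
  otherwise their union is an odd hole.

  In a breadth-first levelling of a component it suffices to colour a connected part \<open>D\<close> of a level,
  at depth at least two. Choose \<open>A1\<close> and then \<open>A2\<close> in the two levels above \<open>D\<close>, each minimally covering
  the previous set. Joining vertices of \<open>A2\<close> through their private children and \<open>D\<close> shows that all
  induced paths within \<open>A2\<close> between two of them have the same parity; so \<open>A2\<close> is a parity graph
  and falls into \<open>2 (w - 1)\<close> stable sets.

  Let \<open>A\<close> be a stable set in a level, attached to a connected set \<open>U\<close> beyond it, and let \<open>B\<close> be the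
  vertices of \<open>U\<close> with a neighbour in \<open>A\<close>. Any two vertices of \<open>A\<close> have a well-defined parity, and the
  pairs of odd parity form a graph \<open>J\<close>. Thinning out the levels below \<open>A\<close> by minimal covers yields a
  spine: a path \<open>S 0, ..., S m\<close> where \<open>S i\<close> is the only parent of \<open>S (i + 1)\<close>. By induction on the level,
  among the vertices of the same parity to the end of the spine, \<open>J\<close> has no induced path on four vertices.
  Assign to each vertex of \<open>B\<close> its first neighbour in \<open>A\<close>. Adjacent vertices not joined to each
  other's assigned neighbours then have assigned neighbours joined in \<open>J\<close>, and this relation is coloured
  by means of the cograph decomposition of \<open>J\<close>. Each class of the resulting
  colouring has clique number at most \<open>w - 1\<close>.
  Going from \<open>A2\<close> to \<open>A1\<close> to \<open>D\<close> in this way gives \<open>16 w\<^sup>2 (w - 1) n\<^sup>2\<close> colours.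
\<close>

section \<open>Induced paths and their parity\<close>

fun ipath :: "('a \<Rightarrow> 'a \<Rightarrow> bool) \<Rightarrow> 'a list \<Rightarrow> bool" where
  "ipath E [] \<longleftrightarrow> True"
| "ipath E [x] \<longleftrightarrow> True"
| "ipath E (x # y # zs) \<longleftrightarrow>
     ipath E (y # zs) \<and> E x y \<and> x \<notin> set (y # zs) \<and> (\<forall>z\<in>set zs. \<not> E x z)"

text \<open>\<open>k\<close> counts edges. Only the interior has to lie in \<open>S\<close>; the
  ends \<open>a\<close> and \<open>b\<close> may or may not.\<close>

definition lnk :: "('a \<Rightarrow> 'a \<Rightarrow> bool) \<Rightarrow> 'a set \<Rightarrow> 'a \<Rightarrow> 'a \<Rightarrow> nat \<Rightarrow> bool" where
  "lnk E S a b k \<longleftrightarrow> (\<exists>xs. ipath E (a # xs @ [b]) \<and> set xs \<subseteq> S \<and> k = Suc (length xs))"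

text \<open>A true \<open>\<epsilon>\<close> means odd. Without any path both values hold vacuously,
  so an argument by parity always has to exhibit a path.\<close>

definition par :: "('a \<Rightarrow> 'a \<Rightarrow> bool) \<Rightarrow> 'a set \<Rightarrow> 'a \<Rightarrow> 'a \<Rightarrow> bool \<Rightarrow> bool" where
  "par E S a b \<epsilon> \<longleftrightarrow> (\<forall>k. lnk E S a b k \<longrightarrow> (odd k \<longleftrightarrow> \<epsilon>))"

text \<open>The odd hole is the induced even path \<open>p\<close> closed up by the vertex \<open>y\<close>.\<close>

definition odd_hole_free :: "('a \<Rightarrow> 'a \<Rightarrow> bool) \<Rightarrow> bool" where
  "odd_hole_free E \<longleftrightarrow> \<not> (\<exists>y p. ipath E p \<and> even (length p) \<and> 4 \<le> length p \<and> y \<notin> set p \<and>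
     (\<forall>z\<in>set p. E y z \<longleftrightarrow> z = hd p \<or> z = last p))"

definition linked :: "('a \<Rightarrow> 'a \<Rightarrow> bool) \<Rightarrow> 'a set \<Rightarrow> 'a \<Rightarrow> 'a \<Rightarrow> bool" where
  "linked E S = (\<lambda>x y. E x y \<and> x \<in> S \<and> y \<in> S)\<^sup>*\<^sup>*"

definition conn :: "('a \<Rightarrow> 'a \<Rightarrow> bool) \<Rightarrow> 'a set \<Rightarrow> bool" where
  "conn E S \<longleftrightarrow> (\<forall>x\<in>S. \<forall>y\<in>S. linked E S x y)"

lemma ipath_Cons:
  "ipath E (x # ys) \<longleftrightarrow> ipath E ys \<and> x \<notin> set ys \<and> (ys \<noteq> [] \<longrightarrow> E x (hd ys)) \<and> (\<forall>z\<in>set (tl ys). \<not> E x z)"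
  by (cases ys) auto

lemma ipath_append_joint:
  assumes "ipath E (xs @ [b])" "ipath E (b # ys)" "set xs \<inter> set ys = {}"
    "\<And>x y. x \<in> set xs \<Longrightarrow> y \<in> set ys \<Longrightarrow> \<not> E x y"
  shows "ipath E (xs @ b # ys)"
  using assms
proof (induction xs)
  case (Cons x xs)
  have 1: "ipath E (xs @ b # ys)"
    using Cons by (auto simp: ipath_Cons)
  have 2: "set (tl (xs @ b # ys)) \<subseteq> set (tl (xs @ [b])) \<union> set ys" by (cases xs) auto
  have 3: "hd (xs @ b # ys) = hd (xs @ [b])" by (cases xs) auto
  show ?case using Cons.prems 1 2 3 by (auto simp: ipath_Cons)
qed auto

lemma ipath_snocI:
  assumes "ipath E xs" "y \<notin> set xs" "xs \<noteq> [] \<Longrightarrow> E (last xs) y" "\<forall>z\<in>set (butlast xs). \<not> E z y"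
  shows "ipath E (xs @ [y])"
  using assms
proof (induction xs)
  case (Cons x xs)
  show ?case
  proof (cases xs)
    case Nil then show ?thesis using Cons by auto
  next
    case (Cons a list)
    then show ?thesis using Cons.prems Cons.IH
      by (auto simp: ipath_Cons)
  qed
qed auto

locale sgraph =
  fixes E :: "'a \<Rightarrow> 'a \<Rightarrow> bool"
  assumes sym: "E x y \<Longrightarrow> E y x" and irrefl: "\<not> E x x"
begin

lemma symI: "E x y \<longleftrightarrow> E y x" using sym by blast

lemma ipath_rev: "ipath E xs \<Longrightarrow> ipath E (rev xs)"
proof (induction xs)
  case (Cons x xs)
  have "ipath E (rev xs @ [x])"
  proof (rule ipath_snocI)
    show "\<forall>z\<in>set (butlast (rev xs)). \<not> E z x"
      using Cons.prems by (cases xs) (auto simp: symI butlast_rev)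
  qed (use Cons in \<open>auto simp: ipath_Cons symI last_rev\<close>)
  then show ?case by simp
qed auto

lemma lnk_sym: "lnk E S a b k \<Longrightarrow> lnk E S b a k"
  unfolding lnk_def
proof (elim exE conjE)
  fix xs assume *: "ipath E (a # xs @ [b])" "set xs \<subseteq> S" "k = Suc (length xs)"
  have "ipath E (b # rev xs @ [a])" using ipath_rev[OF *(1)] by simp
  then show "\<exists>xs. ipath E (b # xs @ [a]) \<and> set xs \<subseteq> S \<and> k = Suc (length xs)"
    using * by (intro exI[of _ "rev xs"]) auto
qed

lemma par_sym: "par E S a b \<epsilon> \<Longrightarrow> par E S b a \<epsilon>"
  unfolding par_def using lnk_sym by blast

lemma lnk_neq: "lnk E S a b k \<Longrightarrow> a \<noteq> b"
  unfolding lnk_def by (auto simp: ipath_Cons)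

lemma lnk_mono: "lnk E S a b k \<Longrightarrow> S \<subseteq> T \<Longrightarrow> lnk E T a b k"
  unfolding lnk_def by blast

lemma par_mono: "par E T a b \<epsilon> \<Longrightarrow> S \<subseteq> T \<Longrightarrow> par E S a b \<epsilon>"
  unfolding par_def using lnk_mono by blast

lemma ipath_distinct: "ipath E xs \<Longrightarrow> distinct xs"
  by (induction xs) (auto simp: ipath_Cons)

lemma lnk_diff: "lnk E S a b k \<Longrightarrow> lnk E (S - {a,b}) a b k"
  unfolding lnk_def
proof (elim exE conjE)
  fix xs assume *: "ipath E (a # xs @ [b])" "set xs \<subseteq> S" "k = Suc (length xs)"
  then show "\<exists>xs. ipath E (a # xs @ [b]) \<and> set xs \<subseteq> S - {a, b} \<and> k = Suc (length xs)"
    using ipath_distinct[OF *(1)] by (intro exI[of _ xs]) auto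
qed

lemma lnk_edge: "E a b \<Longrightarrow> lnk E S a b 1"
  unfolding lnk_def using irrefl by (intro exI[of _ "[]"]) auto

lemma lnk_Cons:
  assumes "lnk E S b c k" "E a b" "\<not> E a c" "a \<noteq> c" "\<And>x. x \<in> S \<Longrightarrow> \<not> E a x" "a \<notin> S"
  shows "lnk E (insert b S) a c (Suc k)"
proof -
  obtain xs where xs: "ipath E (b # xs @ [c])" "set xs \<subseteq> S" "k = Suc (length xs)"
    using assms(1) unfolding lnk_def by blast
  have "ipath E (a # (b # xs) @ [c])"
    using xs assms irrefl by (auto simp: ipath_Cons[of E a])
  then show ?thesis unfolding lnk_def using xs by (intro exI[of _ "b # xs"]) auto
qed

lemma lnk_snoc:
  assumes "lnk E S a b k" "E b c" "\<not> E a c" "a \<noteq> c" "\<And>x. x \<in> S \<Longrightarrow> \<not> E x c" "c \<notin> S"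
  shows "lnk E (insert b S) a c (Suc k)"
  using assms lnk_Cons[of S b a k c] lnk_sym symI by blast

lemma lnk2: "E a b \<Longrightarrow> E b c \<Longrightarrow> \<not> E a c \<Longrightarrow> a \<noteq> c \<Longrightarrow> lnk E {b} a c 2"
  using lnk_Cons[of "{}" b c 1 a] lnk_edge[of b c] by (simp add: numeral_2_eq_2)

lemma linked_refl: "linked E S x x" by (simp add: linked_def)

lemma linked_step: "linked E S x y \<Longrightarrow> E y z \<Longrightarrow> y \<in> S \<Longrightarrow> z \<in> S \<Longrightarrow> linked E S x z"
  unfolding linked_def by (rule rtranclp.rtrancl_into_rtrancl) auto

lemma linked_trans: "linked E S x y \<Longrightarrow> linked E S y z \<Longrightarrow> linked E S x z"
  unfolding linked_def by auto

lemma linked_sym: "linked E S x y \<Longrightarrow> linked E S y x"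
  unfolding linked_def
proof (induction rule: rtranclp_induct)
  case (step y z)
  show ?case by (rule converse_rtranclp_into_rtranclp[OF _ step.IH]) (use step.hyps(2) sym in auto)
qed simp

lemma linked_mono: "linked E S x y \<Longrightarrow> S \<subseteq> T \<Longrightarrow> linked E T x y"
  unfolding linked_def by (erule rtranclp_mono[THEN predicate2D, rotated]) auto


lemma ipath_prefix: "ipath E (xs @ ys) \<Longrightarrow> ipath E xs"
proof (induction xs)
  case (Cons x xs)
  have "hd (xs @ ys) = hd xs" "set (tl xs) \<subseteq> set (tl (xs @ ys))" if "xs \<noteq> []"
    using that by (cases xs; auto)+
  moreover have "ipath E xs" using Cons by (simp add: ipath_Cons)
  ultimately show ?case using Cons.prems unfolding append_Cons ipath_Cons[of E x]
    by (cases "xs = []") auto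
qed simp

text \<open>Cut the path at \<open>z\<close> if \<open>z\<close> lies on it, otherwise at the first
  neighbour of \<open>z\<close>; then no earlier vertex spoils inducedness. This turns walks into
  induced paths.\<close>

lemma ipath_shorten:
  assumes "ipath E xs" "w \<in> set xs" "E w z"
  shows "\<exists>ys. ipath E (ys @ [z]) \<and> set ys \<subseteq> set xs \<and> hd (ys @ [z]) = hd xs"
proof (cases "z \<in> set xs")
  case True
  then obtain ys zs where "xs = ys @ z # zs" by (meson split_list)
  then show ?thesis using assms ipath_prefix[of "ys @ [z]" zs]
    by (intro exI[of _ ys]) (auto simp: hd_append)
next
  case False
  obtain ys v zs where xs: "xs = ys @ v # zs" "E v z" "\<forall>y\<in>set ys. \<not> E y z"
    using split_list_first_prop[of xs "\<lambda>w. E w z"] assms by blast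
  have "ipath E ((ys @ [v]) @ [z])"
  proof (rule ipath_snocI)
    show "ipath E (ys @ [v])" using ipath_prefix[of "ys @ [v]" zs] assms xs by auto
  qed (use xs False in auto)
  then show ?thesis using xs by (intro exI[of _ "ys @ [v]"]) (auto simp: hd_append)
qed

lemma linked_ipath:
  "linked E S a b \<Longrightarrow> a \<in> S \<Longrightarrow> \<exists>xs. ipath E (xs @ [b]) \<and> set xs \<subseteq> S \<and> hd (xs @ [b]) = a"
  unfolding linked_def
proof (induction rule: rtranclp_induct)
  case base
  then show ?case by (intro exI[of _ "[]"]) auto
next
  case (step y z)
  then obtain xs where xs: "ipath E (xs @ [y])" "set xs \<subseteq> S" "hd (xs @ [y]) = a" by auto
  from ipath_shorten[OF xs(1), of y z] step xs show ?case by fastforce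
qed

lemma lnk_exists:
  assumes "conn E C" "u \<in> C" "E a u" "v \<in> C" "E v b" "a \<noteq> b"
  shows "\<exists>k. lnk E C a b k"
proof -
  \<comment> \<open>The ends join \<open>C\<close> for the search; distinctness of the path found
    keeps them out of its interior.\<close>
  let ?T = "insert a (insert b C)"
  have "linked E ?T u v" using assms linked_mono[of C u v ?T] unfolding conn_def by blast
  moreover have "linked E ?T a u" using linked_step[OF linked_refl, of a u ?T] assms by auto
  ultimately have "linked E ?T a b" using linked_step[of ?T a v b] linked_trans assms by blast
  then obtain xs where xs: "ipath E (xs @ [b])" "set xs \<subseteq> ?T" "hd (xs @ [b]) = a"
    using linked_ipath[of ?T a b] by auto
  obtain ys where ys: "xs = a # ys" using xs(3) assms(6) by (cases xs) auto
  have "set ys \<subseteq> C" using ipath_distinct[OF xs(1)] xs(2) ys by auto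
  then show ?thesis unfolding lnk_def using xs ys by (intro exI[of _ "Suc (length ys)"] exI[of _ ys]) auto
qed

text \<open>The two paths close up to an induced cycle of length \<open>k + l\<close>: the interiors
  are nonempty because the ends are nonadjacent, and no edge runs between them. In the form of
  \<open>odd_hole_free\<close>, the vertex \<open>a\<close> closes up the rest.\<close>

lemma glue:
  assumes ohf: "odd_hole_free E"
    and "lnk E S a b k" "lnk E T a b l" "\<not> E a b" "S \<inter> T = {}"
    and anti: "\<And>x y. x \<in> S \<Longrightarrow> y \<in> T \<Longrightarrow> \<not> E x y"
  shows "odd k \<longleftrightarrow> odd l"
proof (rule ccontr)
  assume odd: "odd k \<noteq> odd l"
  obtain ps where ps: "ipath E (a # ps @ [b])" "set ps \<subseteq> S" "k = Suc (length ps)"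
    using assms(2) unfolding lnk_def by blast
  obtain qs where qs: "ipath E (a # qs @ [b])" "set qs \<subseteq> T" "l = Suc (length qs)"
    using assms(3) unfolding lnk_def by blast
  have ne: "ps \<noteq> []" "qs \<noteq> []" using ps(1) qs(1) assms(4) by (auto simp: ipath_Cons)
  let ?p = "ps @ b # rev qs"
  have 1: "ipath E ?p"
  proof (rule ipath_append_joint)
    show "ipath E (ps @ [b])" using ps(1) by (simp add: ipath_Cons)
    have "ipath E (qs @ [b])" using qs(1) by (simp add: ipath_Cons)
    from ipath_rev[OF this] show "ipath E (b # rev qs)" by simp
    show "\<not> E x y" if "x \<in> set ps" "y \<in> set (rev qs)" for x y
      using that anti ps(2) qs(2) by auto
  qed (use ps qs assms(5) in auto)
  have lens: "length ps \<ge> 1" "length qs \<ge> 1" using ne by (simp_all add: Suc_le_eq)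
  \<comment> \<open>The length is \<open>k + l - 1\<close>, which is at least 3 and even, hence at
    least 4.\<close>
  have 2: "even (length ?p)" "4 \<le> length ?p"
    using odd ps(3) qs(3) lens by (simp_all, presburger+)
  have 3: "a \<notin> set ?p" using ipath_distinct[OF ps(1)] ipath_distinct[OF qs(1)] by auto
  have hd: "hd ?p = hd ps" and last: "last ?p = hd qs" using ne by (auto simp: last_rev)
  have "E a z \<longleftrightarrow> z = hd ?p \<or> z = last ?p" if "z \<in> set ?p" for z
  proof -
    have "E a (hd ps)" "E a (hd qs)" using ps(1) qs(1) ne by (auto simp: ipath_Cons)
    moreover have "\<not> E a z" if "z \<in> set ps" "z \<noteq> hd ps"
      using ps(1) ne that by (cases ps) (auto simp: ipath_Cons)
    moreover have "\<not> E a z" if "z \<in> set qs" "z \<noteq> hd qs"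
      using qs(1) ne that by (cases qs) (auto simp: ipath_Cons)
    ultimately show ?thesis using that assms(4) hd last by auto
  qed
  with 1 2 3 ohf show False unfolding odd_hole_free_def by blast
qed

end

section \<open>Colourings and cographs\<close>

definition colb :: "('a \<Rightarrow> 'a \<Rightarrow> bool) \<Rightarrow> 'a set \<Rightarrow> nat \<Rightarrow> bool" where
  "colb E W k \<longleftrightarrow> (\<exists>f::'a \<Rightarrow> nat. (\<forall>x\<in>W. f x < k) \<and> (\<forall>x\<in>W. \<forall>y\<in>W. E x y \<longrightarrow> f x \<noteq> f y))"

definition clq :: "('a \<Rightarrow> 'a \<Rightarrow> bool) \<Rightarrow> 'a set \<Rightarrow> bool" where
  "clq E K \<longleftrightarrow> (\<forall>x\<in>K. \<forall>y\<in>K. x \<noteq> y \<longrightarrow> E x y)"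

definition clb :: "('a \<Rightarrow> 'a \<Rightarrow> bool) \<Rightarrow> 'a set \<Rightarrow> nat \<Rightarrow> bool" where
  "clb E W w \<longleftrightarrow> (\<forall>K. K \<subseteq> W \<longrightarrow> clq E K \<longrightarrow> card K \<le> w)"

text \<open>For symmetric irreflexive \<open>J\<close> a violating quadruple is automatically
  distinct, so this is the absence of an induced path on four vertices.\<close>

definition p4free :: "('a \<Rightarrow> 'a \<Rightarrow> bool) \<Rightarrow> 'a set \<Rightarrow> bool" where
  "p4free J V \<longleftrightarrow> (\<forall>a\<in>V. \<forall>b\<in>V. \<forall>c\<in>V. \<forall>d\<in>V. J a b \<longrightarrow> J b c \<longrightarrow> J c d \<longrightarrow> J a c \<or> J b d \<or> J a d)"

lemma p4freeD: "p4free J V \<Longrightarrow> {a,b,c,d} \<subseteq> V \<Longrightarrow> J a b \<Longrightarrow> J b c \<Longrightarrow> J c d \<Longrightarrow> J a c \<or> J b d \<or> J a d"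
  unfolding p4free_def by blast

lemma p4free_subset: "p4free J V \<Longrightarrow> U \<subseteq> V \<Longrightarrow> p4free J U"
  unfolding p4free_def by blast

lemma colb_mono:
  assumes "colb E W k" "U \<subseteq> W" "k \<le> l" shows "colb E U l"
proof -
  obtain f :: "'a \<Rightarrow> nat" where f: "\<forall>x\<in>W. f x < k" "\<forall>x\<in>W. \<forall>y\<in>W. E x y \<longrightarrow> f x \<noteq> f y"
    using assms(1) unfolding colb_def by blast
  have "f x < l" if "x \<in> U" for x using f(1) that assms by force
  moreover have "\<forall>x\<in>U. \<forall>y\<in>U. E x y \<longrightarrow> f x \<noteq> f y" using f(2) assms(2) by blast
  ultimately show ?thesis unfolding colb_def by blast
qed

lemma clb_mono:
  assumes "clb E W k" "U \<subseteq> W" "k \<le> l" shows "clb E U l"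
  unfolding clb_def
proof (intro allI impI)
  fix K assume "K \<subseteq> U" "clq E K"
  then have "card K \<le> k" using assms unfolding clb_def by blast
  then show "card K \<le> l" using assms by simp
qed

lemma colb_stable: "(\<And>x y. x \<in> W \<Longrightarrow> y \<in> W \<Longrightarrow> \<not> E x y) \<Longrightarrow> 1 \<le> k \<Longrightarrow> colb E W k"
  unfolding colb_def by (intro exI[of _ "\<lambda>_. 0"]) auto

lemma colb_comps:
  assumes "\<And>x y. x \<in> W \<Longrightarrow> y \<in> W \<Longrightarrow> E x y \<Longrightarrow> h x = h y"
    and "\<And>x. x \<in> W \<Longrightarrow> colb E {y\<in>W. h y = h x} k"
  shows "colb E W k"
proof -
  have "\<forall>c\<in>h ` W. \<exists>f::'a \<Rightarrow> nat. (\<forall>x\<in>W. h x = c \<longrightarrow> f x < k) \<and>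
     (\<forall>x\<in>W. \<forall>y\<in>W. h x = c \<longrightarrow> h y = c \<longrightarrow> E x y \<longrightarrow> f x \<noteq> f y)"
  proof
    fix c assume "c \<in> h ` W"
    then obtain z where "z \<in> W" "c = h z" by blast
    with assms(2)[of z] obtain f :: "'a \<Rightarrow> nat" where
      "\<forall>x\<in>{y\<in>W. h y = c}. f x < k"
      "\<forall>x\<in>{y\<in>W. h y = c}. \<forall>y\<in>{y\<in>W. h y = c}. E x y \<longrightarrow> f x \<noteq> f y"
      unfolding colb_def by blast
    then show "\<exists>f::'a \<Rightarrow> nat. (\<forall>x\<in>W. h x = c \<longrightarrow> f x < k) \<and>
     (\<forall>x\<in>W. \<forall>y\<in>W. h x = c \<longrightarrow> h y = c \<longrightarrow> E x y \<longrightarrow> f x \<noteq> f y)"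
      by (intro exI[of _ f]) auto
  qed
  from bchoice[OF this] obtain F :: "'b \<Rightarrow> 'a \<Rightarrow> nat" where F: "\<forall>c\<in>h ` W. (\<forall>x\<in>W. h x = c \<longrightarrow> F c x < k) \<and>
     (\<forall>x\<in>W. \<forall>y\<in>W. h x = c \<longrightarrow> h y = c \<longrightarrow> E x y \<longrightarrow> F c x \<noteq> F c y)" by blast
  show ?thesis unfolding colb_def
  proof (intro exI[of _ "\<lambda>x. F (h x) x"] conjI ballI impI)
    show "F (h x) x < k" if "x \<in> W" for x using F that by blast
    show "F (h x) x \<noteq> F (h y) y" if "x \<in> W" "y \<in> W" "E x y" for x y
      using F that(1,2,3) assms(1)[OF that] by (metis imageI)
  qed
qed

lemma colb_fibres:
  assumes "\<And>x. x \<in> W \<Longrightarrow> g x < m" and "\<And>c. c < m \<Longrightarrow> colb E {x\<in>W. g x = c} n"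
  shows "colb E W (m * n)"
proof -
  have "\<forall>c\<in>{..<m}. \<exists>f::'a \<Rightarrow> nat. (\<forall>x\<in>W. g x = c \<longrightarrow> f x < n) \<and>
     (\<forall>x\<in>W. \<forall>y\<in>W. g x = c \<longrightarrow> g y = c \<longrightarrow> E x y \<longrightarrow> f x \<noteq> f y)"
  proof
    fix c assume "c \<in> {..<m}"
    with assms(2)[of c] obtain f :: "'a \<Rightarrow> nat" where
      "\<forall>x\<in>{y\<in>W. g y = c}. f x < n"
      "\<forall>x\<in>{y\<in>W. g y = c}. \<forall>y\<in>{y\<in>W. g y = c}. E x y \<longrightarrow> f x \<noteq> f y"
      unfolding colb_def by blast
    then show "\<exists>f::'a \<Rightarrow> nat. (\<forall>x\<in>W. g x = c \<longrightarrow> f x < n) \<and>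
     (\<forall>x\<in>W. \<forall>y\<in>W. g x = c \<longrightarrow> g y = c \<longrightarrow> E x y \<longrightarrow> f x \<noteq> f y)"
      by (intro exI[of _ f]) auto
  qed
  from bchoice[OF this] obtain F :: "nat \<Rightarrow> 'a \<Rightarrow> nat" where F: "\<forall>c\<in>{..<m}. (\<forall>x\<in>W. g x = c \<longrightarrow> F c x < n) \<and>
     (\<forall>x\<in>W. \<forall>y\<in>W. g x = c \<longrightarrow> g y = c \<longrightarrow> E x y \<longrightarrow> F c x \<noteq> F c y)" by blast
  have lt: "F (g x) x < n" if "x \<in> W" for x using F assms(1) that by blast
  show ?thesis unfolding colb_def
  \<comment> \<open>The pair of the class \<open>g x\<close> and the colour inside it, coded as one
    number below \<open>m * n\<close>; division by \<open>n\<close> recovers the class.\<close>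
  proof (intro exI[of _ "\<lambda>x. g x * n + F (g x) x"] conjI ballI impI)
    show "g x * n + F (g x) x < m * n" if "x \<in> W" for x
    proof -
      have "g x * n + F (g x) x < Suc (g x) * n" using lt[OF that] by simp
      also have "\<dots> \<le> m * n" using assms(1)[OF that] by (intro mult_right_mono) auto
      finally show ?thesis .
    qed
    show "g x * n + F (g x) x \<noteq> g y * n + F (g y) y" if xy: "x \<in> W" "y \<in> W" "E x y" for x y
    proof
      assume eq: "g x * n + F (g x) x = g y * n + F (g y) y"
      have "(g x * n + F (g x) x) div n = g x" "(g y * n + F (g y) y) div n = g y"
        using lt[OF xy(1)] lt[OF xy(2)] by (cases "n = 0"; simp)+
      then have g: "g x = g y" using eq by simp
      then show False using eq F xy assms(1) by (metis add_left_cancel lessThan_iff)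
    qed
  qed
qed

text \<open>Distinct levels of equal parity are anticomplete and share \<open>k\<close> colours; the
  factor 2 separates even from odd levels.\<close>

lemma colb_levels:
  assumes "\<And>x y. x \<in> W \<Longrightarrow> y \<in> W \<Longrightarrow> E x y \<Longrightarrow> d x \<le> Suc (d y) \<and> d y \<le> Suc (d x)"
    and "\<And>i. colb E {x\<in>W. d x = i} k"
  shows "colb E W (2 * k)"
proof (rule colb_fibres[of _ "\<lambda>x. d x mod 2"])
  fix c :: nat assume "c < 2"
  show "colb E {x\<in>W. d x mod 2 = c} k"
  proof (rule colb_comps[of _ _ d])
    fix x y assume "x \<in> {x\<in>W. d x mod 2 = c}" "y \<in> {x\<in>W. d x mod 2 = c}" "E x y"
    then have "d x \<le> Suc (d y)" "d y \<le> Suc (d x)" "d x mod 2 = d y mod 2" using assms(1)[of x y] by auto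
    then show "d x = d y" by presburger
  next
    fix x show "colb E {y \<in> {x \<in> W. d x mod 2 = c}. d y = d x} k"
      using assms(2)[of "d x"] by (rule colb_mono) auto
  qed
qed auto

section \<open>Cographs and Seinsche's theorem\<close>

definition split2 :: "('a \<Rightarrow> 'a \<Rightarrow> bool) \<Rightarrow> 'a set \<Rightarrow> bool" where
  "split2 J V \<longleftrightarrow> (\<exists>P Q. P \<union> Q = V \<and> P \<inter> Q = {} \<and> P \<noteq> {} \<and> Q \<noteq> {} \<and> (\<forall>x\<in>P. \<forall>y\<in>Q. \<not> J x y))"

text \<open>\<open>split2 J V\<close> says that \<open>J\<close> is disconnected on
  \<open>V\<close>. If \<open>v\<close> has no neighbour in some component of \<open>V\<close>, that
  component still splits off. Otherwise a non-neighbour \<open>u\<close> of \<open>v\<close> yields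
  an edge \<open>y x\<close> in its component with only \<open>x\<close> adjacent to
  \<open>v\<close>; with a neighbour \<open>z\<close> of \<open>v\<close> in another component,
  \<open>y, x, v, z\<close> is an induced path.\<close>

lemma split2_step:
  assumes "sgraph J" "p4free J (insert v V)" "v \<notin> V" "split2 J V"
  shows "split2 J (insert v V) \<or> (\<forall>x\<in>V. J v x)"
proof (rule disjCI)
  interpret sgraph J by fact
  assume "\<not> (\<forall>x\<in>V. J v x)"
  then obtain u where u: "u \<in> V" "\<not> J v u" by blast
  define C where "C y = {x\<in>V. linked J V y x}" for y
  obtain P Q where PQ: "P \<union> Q = V" "P \<inter> Q = {}" "P \<noteq> {}" "Q \<noteq> {}" "\<forall>x\<in>P. \<forall>y\<in>Q. \<not> J x y"
    using assms(4) unfolding split2_def by blast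
  show "split2 J (insert v V)"
  proof (cases "\<exists>y\<in>V. \<forall>x\<in>C y. \<not> J v x")
    case True
    then obtain y where y: "y \<in> V" "\<forall>x\<in>C y. \<not> J v x" by blast
    have "y \<in> C y" using y linked_refl by (auto simp: C_def)
    moreover have "\<not> J a b" if "a \<in> C y" "b \<in> insert v V - C y" for a b
      using that y linked_step[of V y a b] symI[of a b] unfolding C_def by auto
    ultimately show ?thesis unfolding split2_def
      using \<open>v \<notin> V\<close> by (intro exI[of _ "C y"] exI[of _ "insert v V - C y"]) (auto simp: C_def)
  next
    case False
    have side: "linked J V u x \<Longrightarrow> u \<in> S \<Longrightarrow> x \<in> S" if "S = P \<or> S = Q" for S x
      unfolding linked_def
    proof (induction rule: rtranclp_induct)
      case (step a b) then show ?case using PQ that symI by blast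
    qed
    obtain w where w: "w \<in> V" "\<And>x. x \<in> C u \<Longrightarrow> \<not> linked J V w x"
    proof -
      consider "u \<in> P" | "u \<in> Q" using u PQ by blast
      then show ?thesis
      proof cases
        case 1
        obtain w where "w \<in> Q" using PQ by blast
        show ?thesis
        proof (rule that[of w])
          fix x assume x: "x \<in> C u"
          show "\<not> linked J V w x"
          proof
            assume "linked J V w x"
            then have "linked J V u w" using x linked_trans linked_sym unfolding C_def by blast
            then have "w \<in> P" using side[of P w] 1 by blast
            then show False using PQ \<open>w \<in> Q\<close> by blast
          qed
        qed (use \<open>w \<in> Q\<close> PQ in blast)
      next
        case 2
        obtain w where "w \<in> P" using PQ by blast
        show ?thesis
        proof (rule that[of w])
          fix x assume x: "x \<in> C u"
          show "\<not> linked J V w x"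
          proof
            assume "linked J V w x"
            then have "linked J V u w" using x linked_trans linked_sym unfolding C_def by blast
            then have "w \<in> Q" using side[of Q w] 2 by blast
            then show False using PQ \<open>w \<in> P\<close> by blast
          qed
        qed (use \<open>w \<in> P\<close> PQ in blast)
      qed
    qed
    obtain z where z: "z \<in> C w" "J v z" using False w(1) by blast
    obtain x0 where x0: "x0 \<in> C u" "J v x0" using False u(1) by blast
    \<comment> \<open>On the way from the non-neighbour \<open>u\<close> to the neighbour
      \<open>x0\<close> some edge enters the neighbourhood of \<open>v\<close>.\<close>
    have "\<exists>y x. y \<in> C u \<and> x \<in> C u \<and> J y x \<and> \<not> J v y \<and> J v x"
    proof -
      have "linked J V u x \<Longrightarrow> J v x \<Longrightarrow> \<exists>y x. y \<in> C u \<and> x \<in> C u \<and> J y x \<and> \<not> J v y \<and> J v x" for x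
        unfolding linked_def
      proof (induction rule: rtranclp_induct)
        case base then show ?case using u by blast
      next
        case (step a b)
        have "a \<in> C u" using step.hyps unfolding C_def linked_def by auto
        moreover have "linked J V u b" using step.hyps linked_step unfolding linked_def by blast
        then have "b \<in> C u" using step.hyps unfolding C_def by auto
        ultimately show ?case using step by blast
      qed
      then show ?thesis using x0 unfolding C_def by blast
    qed
    then obtain y x where yx: "y \<in> C u" "x \<in> C u" "J y x" "\<not> J v y" "J v x" by blast
    have nz: "\<not> J a z" if "a \<in> C u" for a
    proof
      assume "J a z"
      then have "linked J V w a" using z that linked_step[of V w z a] sym unfolding C_def by blast
      then show False using w(2) that by blast
    qed
    have "J y v \<or> J x z \<or> J y z"
      using p4freeD[OF assms(2), of y x v z] yx z symI unfolding C_def by blast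
    then show ?thesis using nz yx symI by blast
  qed
qed

abbreviation co :: "('a \<Rightarrow> 'a \<Rightarrow> bool) \<Rightarrow> 'a \<Rightarrow> 'a \<Rightarrow> bool" where
  "co J \<equiv> (\<lambda>x y. x \<noteq> y \<and> \<not> J x y)"

text \<open>The path on four vertices is self-complementary: \<open>a, b, c, d\<close> in the
  complement is \<open>b, d, a, c\<close> in \<open>J\<close>.\<close>

lemma p4free_co:
  assumes "sgraph J" "p4free J V" shows "p4free (co J) V"
  unfolding p4free_def
proof (intro ballI impI)
  interpret sgraph J by fact
  fix a b c d assume V: "a \<in> V" "b \<in> V" "c \<in> V" "d \<in> V" and e: "co J a b" "co J b c" "co J c d"
  show "co J a c \<or> co J b d \<or> co J a d"
  proof (rule ccontr)
    assume n: "\<not> (co J a c \<or> co J b d \<or> co J a d)"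
    have "a \<noteq> d" using e n symI by blast
    then have "J d a" using n symI by blast
    moreover have "J a c" using n e by (metis (full_types) \<open>a \<noteq> d\<close>)
    moreover have "J b d" using n e by (metis (full_types) \<open>a \<noteq> d\<close>)
    ultimately show False
      using p4freeD[OF assms(2), of b d a c] V e symI by blast
  qed
qed

lemma sgraph_co: "sgraph J \<Longrightarrow> sgraph (co J)"
  unfolding sgraph_def by blast

text \<open>Vertices are added one at a time. \<open>split2_step\<close> applies to \<open>J\<close>
  or to its complement, whichever is disconnected so far; a new vertex complete or anticomplete to
  the rest splits off by itself.\<close>

lemma seinsche:
  assumes "finite V" "2 \<le> card V" "sgraph J" "p4free J V"
  shows "split2 J V \<or> split2 (co J) V"
  using assms
proof (induction V rule: finite_induct)
  case (insert v V)
  interpret sgraph J by fact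
  have all: "split2 (co J) (insert v V)" if "\<forall>x\<in>V. J v x" "V \<noteq> {}"
    unfolding split2_def using that insert.hyps by (intro exI[of _ "{v}"] exI[of _ V]) auto
  have none: "split2 J (insert v V)" if "\<forall>x\<in>V. co J v x" "V \<noteq> {}"
    unfolding split2_def using that insert.hyps by (intro exI[of _ "{v}"] exI[of _ V]) auto
  show ?case
  proof (cases "2 \<le> card V")
    case True
    then have ne: "V \<noteq> {}" by auto
    have "split2 J V \<or> split2 (co J) V"
      using insert True p4free_subset by blast
    then show ?thesis
    proof
      assume "split2 J V"
      then show ?thesis using split2_step[of J v V] insert.prems insert.hyps all ne by blast
    next
      assume "split2 (co J) V"
      then show ?thesis using split2_step[of "co J" v V] sgraph_co p4free_co insert.prems insert.hyps none ne
        by blast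
    qed
  next
    case False
    then have "card V = 1" using insert.prems insert.hyps by simp
    then obtain u where "V = {u}" by (auto simp: card_1_singleton_iff)
    then show ?thesis using all none insert.hyps by blast
  qed
qed auto


definition cliqno :: "('a \<Rightarrow> 'a \<Rightarrow> bool) \<Rightarrow> 'a set \<Rightarrow> nat" where
  "cliqno E W = Max (card ` {K. K \<subseteq> W \<and> clq E K})"

lemma cliqno_clb: "finite W \<Longrightarrow> clb E W (cliqno E W)"
  unfolding clb_def cliqno_def by (auto intro!: Max_ge)

lemma cliqno_attained:
  assumes "finite W" shows "\<exists>K\<subseteq>W. clq E K \<and> card K = cliqno E W"
proof -
  have "{} \<in> {K. K \<subseteq> W \<and> clq E K}" by (auto simp: clq_def)
  then have "cliqno E W \<in> card ` {K. K \<subseteq> W \<and> clq E K}"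
    unfolding cliqno_def using assms by (intro Max_in) auto
  then show ?thesis by auto
qed

text \<open>A cograph splits into two parts with all or none of the \<open>J\<close>-edges between them. In the first case the
  \<open>R\<close>-components of the two parts are pairwise complete or anticomplete in \<open>R\<close>; the
  components of one part take their colours from below, those of the other from above.\<close>

lemma cograph_colouring:
  assumes "finite T" "sgraph R" "sgraph J" "\<And>x y. R x y \<Longrightarrow> J x y" "p4free J T"
    and "\<And>b c d. {b,c,d} \<subseteq> T \<Longrightarrow> R b c \<Longrightarrow> R c d \<Longrightarrow> J b d \<Longrightarrow> R b d"
    and "clb R T k"
  shows "colb R T k"
  using assms(1,5,6,7)
proof (induction "card T" arbitrary: T k rule: less_induct)
  case less
  interpret R: sgraph R by fact
  interpret J: sgraph J by fact
  show ?case
  proof (cases "2 \<le> card T")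
    case False
    show ?thesis
    proof (cases "T = {}")
      case True then show ?thesis by (simp add: colb_def)
    next
      case ne: False
      then have "card T = 1" using False less.prems(1) card_gt_0_iff[of T] by linarith
      then obtain t where t: "T = {t}" by (auto simp: card_1_singleton_iff)
      then have "1 \<le> k" using less.prems(4) unfolding clb_def clq_def by (metis (no_types, lifting) One_nat_def card.empty card.insert empty_iff finite.emptyI order_refl singletonD)
      then show ?thesis using t R.irrefl by (intro colb_stable) auto
    qed
  next
    case True
    then consider "split2 J T" | "split2 (co J) T"
      using seinsche[OF less.prems(1) _ assms(3) less.prems(2)] by blast
    then show ?thesis
    proof cases
      case 1
      then obtain P Q where PQ: "P \<union> Q = T" "P \<inter> Q = {}" "P \<noteq> {}" "Q \<noteq> {}" "\<forall>x\<in>P. \<forall>y\<in>Q. \<not> J x y"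
        unfolding split2_def by blast
      have col: "colb R S k" if "S = P \<or> S = Q" for S
      proof (rule less.hyps)
        have "S \<subset> T" using PQ(1-4) that by blast
        then show "card S < card T" by (rule psubset_card_mono[OF less.prems(1)])
        have "S \<subseteq> T" using \<open>S \<subset> T\<close> by blast
        then show "p4free J S" by (rule p4free_subset[OF less.prems(2)])
        show "clb R S k" by (rule clb_mono[OF less.prems(4) \<open>S \<subseteq> T\<close> order_refl])
        show "finite S" using that PQ less.prems(1) finite_subset[of S T] by blast
        show "R b d" if "{b,c,d} \<subseteq> S" "R b c" "R c d" "J b d" for b c d
          using less.prems(3)[of b c d] that \<open>S \<subseteq> T\<close> by auto
      qed
      show ?thesis
      proof (rule colb_comps[of T R "\<lambda>x. x \<in> P"])
        show "(x \<in> P) = (y \<in> P)" if xy: "x \<in> T" "y \<in> T" "R x y" for x y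
        proof -
          have "J x y" "J y x" using assms(4)[OF xy(3)] J.sym by auto
          then show ?thesis using xy(1,2) PQ(1,5) by auto
        qed
        show "colb R {y \<in> T. (y \<in> P) = (x \<in> P)} k" if "x \<in> T" for x
        proof (cases "x \<in> P")
          case True
          then have "{y \<in> T. (y \<in> P) = (x \<in> P)} = P" using PQ(1,2) by auto
          then show ?thesis using col by simp
        next
          case False
          then have "{y \<in> T. (y \<in> P) = (x \<in> P)} = Q" using PQ(1,2) by auto
          then show ?thesis using col by simp
        qed
      qed
    next
      case 2
      then obtain P Q where PQ0: "P \<union> Q = T" "P \<inter> Q = {}" "P \<noteq> {}" "Q \<noteq> {}"
        and PQ1: "\<forall>x\<in>P. \<forall>y\<in>Q. \<not> co J x y"
        unfolding split2_def by blast
      have "J x y" if "x \<in> P" "y \<in> Q" for x y using PQ1 PQ0(2) that by (metis disjoint_iff)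
      with PQ0 have PQ: "P \<union> Q = T" "P \<inter> Q = {}" "P \<noteq> {}" "Q \<noteq> {}" "\<forall>x\<in>P. \<forall>y\<in>Q. J x y"
        by auto
      define C where "C S x = {y\<in>S. linked R S x y}" for S x
      have fin: "finite P" "finite Q" using PQ(1) less.prems(1) by auto
      have CS: "C S x \<subseteq> S" for S x unfolding C_def by blast
      have C_self: "x \<in> S \<Longrightarrow> x \<in> C S x" for S x unfolding C_def using R.linked_refl by blast
      have C_eq: "C S x = C S y" if "x \<in> S" "y \<in> S" "R x y" for S x y
      proof -
        have "linked R S x y" "linked R S y x" using that R.linked_step[OF R.linked_refl] R.sym by blast+
        then show ?thesis unfolding C_def using R.linked_trans by blast
      qed
      have C_mem: "C S x = C S y" if "y \<in> C S x" for S x y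
        using that R.linked_trans R.linked_sym unfolding C_def by blast
      \<comment> \<open>An \<open>R\<close>-edge from \<open>y\<close> across to \<open>w\<close>
        spreads over the component of \<open>y\<close>: for the next edge \<open>a b\<close> of the
        component, \<open>R b a\<close>, \<open>R a w\<close> and the cross edge
        \<open>J b w\<close> give \<open>R b w\<close>.\<close>
      have complete: "R y' w" if "y' \<in> C S y" "R y w" "w \<in> S'" "y \<in> S" "(S,S') = (P,Q) \<or> (S,S') = (Q,P)"
        for S S' y y' w
      proof -
        have "linked R S y y'" using that unfolding C_def by blast
        then show ?thesis unfolding linked_def
        proof (induction rule: rtranclp_induct)
          case base then show ?case using that by blast
        next
          case (step a b)
          have "J b w" using step.hyps that PQ J.symI by blast
          moreover have "{b,a,w} \<subseteq> T" using step.hyps that PQ by auto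
          ultimately show ?case using less.prems(3)[of b a w] step R.symI by blast
        qed
      qed
      \<comment> \<open>By the induction hypothesis each component needs only as many colours as its
        own clique number.\<close>
      have comp_col: "colb R (C S x) (cliqno R (C S x))" if "S = P \<or> S = Q" for S x
      proof (rule less.hyps)
        have "C S x \<subset> T" using CS[of S x] PQ(1-4) that by blast
        then show "card (C S x) < card T" by (rule psubset_card_mono[OF less.prems(1)])
        have sub: "C S x \<subseteq> T" using \<open>C S x \<subset> T\<close> by blast
        show "p4free J (C S x)" by (rule p4free_subset[OF less.prems(2) sub(1)])
        show "finite (C S x)" using sub less.prems(1) finite_subset by blast
        then show "clb R (C S x) (cliqno R (C S x))" by (rule cliqno_clb)
        show "R b d" if "{b,c,d} \<subseteq> C S x" "R b c" "R c d" "J b d" for b c d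
          using less.prems(3)[of b c d] that sub(1) by auto
      qed
      define Ds where "Ds = {C S x | S x. S = P \<or> S = Q}"
      have "\<forall>D\<in>Ds. \<exists>f::'a\<Rightarrow>nat. (\<forall>y\<in>D. f y < cliqno R D) \<and>
          (\<forall>y\<in>D. \<forall>z\<in>D. R y z \<longrightarrow> f y \<noteq> f z)"
      proof
        fix D assume "D \<in> Ds"
        then obtain S x where D: "D = C S x" "S = P \<or> S = Q" unfolding Ds_def by auto
        show "\<exists>f::'a\<Rightarrow>nat. (\<forall>y\<in>D. f y < cliqno R D) \<and> (\<forall>y\<in>D. \<forall>z\<in>D. R y z \<longrightarrow> f y \<noteq> f z)"
          using comp_col[OF D(2), of x] unfolding D(1) colb_def .
      qed
      from bchoice[OF this] obtain f :: "'a set \<Rightarrow> 'a \<Rightarrow> nat" where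
        f: "\<forall>D\<in>Ds. (\<forall>y\<in>D. f D y < cliqno R D) \<and> (\<forall>y\<in>D. \<forall>z\<in>D. R y z \<longrightarrow> f D y \<noteq> f D z)"
        by blast
      have Ds: "C S x \<in> Ds" if "S = P \<or> S = Q" for S x using that unfolding Ds_def by auto
      have f1: "f (C S x) y < cliqno R (C S x)" if "S = P \<or> S = Q" "y \<in> C S x" for S x y
        using bspec[OF f Ds[OF that(1), of x]] that(2) by simp
      have f2: "f (C S x) y \<noteq> f (C S x) z" if "S = P \<or> S = Q" "y \<in> C S x" "z \<in> C S x" "R y z" for S x y z
        using bspec[OF f Ds[OF that(1), of x]] that(2-) by simp
      have finC: "finite (C S x)" if "S = P \<or> S = Q" for S x using finite_subset[OF CS[of S x]] fin that by auto
      have le: "cliqno R (C S x) \<le> k" if S: "S = P \<or> S = Q" for S x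
      proof -
        obtain K where K: "K \<subseteq> C S x" "clq R K" "card K = cliqno R (C S x)"
          using cliqno_attained[OF finC[OF S, of x]] by blast
        then have "K \<subseteq> T" using CS[of S x] S PQ(1) by auto
        then show ?thesis using K less.prems(4) unfolding clb_def by metis
      qed
      \<comment> \<open>Components joined by an edge are complete to each other, so their largest
        cliques unite to a clique.\<close>
      have add: "cliqno R (C P x) + cliqno R (C Q y) \<le> k" if xy: "x \<in> P" "y \<in> Q" "R x y" for x y
      proof -
        obtain K where K: "K \<subseteq> C P x" "clq R K" "card K = cliqno R (C P x)"
          using cliqno_attained[OF finC[of P x]] by blast
        obtain L where L: "L \<subseteq> C Q y" "clq R L" "card L = cliqno R (C Q y)"
          using cliqno_attained[OF finC[of Q y]] by blast
        have R: "R a b" if "a \<in> K" "b \<in> L" for a b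
        proof -
          have "R a y" using complete[of a P x y Q] K(1) that(1) xy by auto
          moreover have "a \<in> P" using K(1) CS[of P x] that(1) by auto
          ultimately have "R b a" using complete[of b Q y a P] L(1) that(2) xy(2) R.sym[of a y] by auto
          then show ?thesis by (rule R.sym)
        qed
        have KL: "K \<subseteq> P" "L \<subseteq> Q" using K L CS[of P x] CS[of Q y] by auto
        have "clq R (K \<union> L)" using K(2) L(2) R R.sym unfolding clq_def by blast
        moreover have "K \<union> L \<subseteq> T" using KL PQ(1) by auto
        ultimately have "card (K \<union> L) \<le> k" using less.prems(4) unfolding clb_def by blast
        moreover have "card (K \<union> L) = card K + card L"
          using KL PQ(2) finite_subset[OF KL(1) fin(1)] finite_subset[OF KL(2) fin(2)]
          by (intro card_Un_disjoint) auto
        ultimately show ?thesis using K L by simp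
      qed
      define g where "g x = (if x \<in> P then f (C P x) x else k - 1 - f (C Q x) x)" for x
      have gP: "g x < cliqno R (C P x)" "g x = f (C P x) x" if "x \<in> P" for x
        using f1[of P x x] C_self that by (auto simp: g_def)
      have gQ: "k \<le> g x + cliqno R (C Q x)" "g x < k" "g x = k - 1 - f (C Q x) x" "f (C Q x) x < k"
        if "x \<in> Q" for x
      proof -
        have "f (C Q x) x < cliqno R (C Q x)" using f1[of Q x x] C_self that by blast
        moreover have "cliqno R (C Q x) \<le> k" using le by blast
        moreover show 1: "g x = k - 1 - f (C Q x) x" using that PQ by (auto simp: g_def)
        ultimately show "k \<le> g x + cliqno R (C Q x)" "g x < k" "f (C Q x) x < k" by linarith+
      qed
      \<comment> \<open>\<open>g x\<close> is below \<open>cliqno R (C P x)\<close> and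
        \<open>g y\<close> is at least \<open>k - cliqno R (C Q y)\<close>; by \<open>add\<close>
        these ranges are disjoint.\<close>
      have cross: "g x \<noteq> g y" if "x \<in> P" "y \<in> Q" "R x y" for x y
        using gP[OF that(1)] gQ[OF that(2)] add[OF that] by linarith
      have inP: "g x \<noteq> g y" if "x \<in> P" "y \<in> P" "R x y" for x y
      proof -
        have "C P x = C P y" using C_eq that by blast
        then show ?thesis using f2[of P x x y] C_self[of x P] C_self[of y P] gP that by simp
      qed
      have inQ: "g x \<noteq> g y" if "x \<in> Q" "y \<in> Q" "R x y" for x y
      proof -
        have "C Q x = C Q y" using C_eq that by blast
        then have "f (C Q x) x \<noteq> f (C Q y) y" using f2[of Q x x y] C_self[of x Q] C_self[of y Q] that by simp
        then show ?thesis using gQ[OF that(1)] gQ[OF that(2)] by linarith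
      qed
      show ?thesis unfolding colb_def
      proof (intro exI[of _ g] conjI ballI impI)
        fix x assume "x \<in> T"
        then show "g x < k" using gP[of x] gQ[of x] le[of P x] PQ by (metis Un_iff order_less_le_trans)
      next
        fix x y assume "x \<in> T" "y \<in> T" "R x y"
        then show "g x \<noteq> g y" using cross[of x y] cross[of y x] inP inQ R.sym PQ by (metis Un_iff)
      qed
    qed
  qed
qed

section \<open>Levellings with a spine\<close>

definition levelling :: "('a \<Rightarrow> 'a \<Rightarrow> bool) \<Rightarrow> (nat \<Rightarrow> 'a set) \<Rightarrow> nat \<Rightarrow> bool" where
  "levelling E L m \<longleftrightarrow>
     (\<forall>i\<le>m. \<forall>j\<le>m. i \<noteq> j \<longrightarrow> L i \<inter> L j = {}) \<and>
     (\<forall>i\<le>m. \<forall>j\<le>m. i + 2 \<le> j \<longrightarrow> (\<forall>x\<in>L i. \<forall>y\<in>L j. \<not> E x y)) \<and>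
     (\<forall>i<m. \<forall>v\<in>L (Suc i). \<exists>u\<in>L i. E u v) \<and> (\<exists>r. L 0 = {r})"

definition spine :: "('a \<Rightarrow> 'a \<Rightarrow> bool) \<Rightarrow> (nat \<Rightarrow> 'a set) \<Rightarrow> (nat \<Rightarrow> 'a) \<Rightarrow> nat \<Rightarrow> bool" where
  "spine E L S m \<longleftrightarrow> (\<forall>i\<le>m. S i \<in> L i) \<and> (\<forall>i<m. \<forall>u\<in>L i. E u (S (Suc i)) \<longleftrightarrow> u = S i)"

abbreviation below :: "(nat \<Rightarrow> 'a set) \<Rightarrow> nat \<Rightarrow> 'a set" where
  "below L i \<equiv> (\<Union>j<i. L j)"

lemma levelling_disj:
  assumes "levelling E L m" "i \<le> m" "j \<le> m" "x \<in> L i" "x \<in> L j" shows "i = j"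
proof (rule ccontr)
  assume "i \<noteq> j"
  have "\<forall>i\<le>m. \<forall>j\<le>m. i \<noteq> j \<longrightarrow> L i \<inter> L j = {}" using assms(1) unfolding levelling_def by (elim conjE)
  then have "L i \<inter> L j = {}" using assms(2,3) \<open>i \<noteq> j\<close> by simp
  then show False using assms(4,5) by auto
qed

lemma levelling_far:
  assumes "levelling E L m" "j \<le> m" "i + 2 \<le> j" "x \<in> L i" "y \<in> L j" shows "\<not> E x y"
proof -
  have "\<forall>i\<le>m. \<forall>j\<le>m. i + 2 \<le> j \<longrightarrow> (\<forall>x\<in>L i. \<forall>y\<in>L j. \<not> E x y)"
    using assms(1) unfolding levelling_def by (elim conjE)
  moreover have "i \<le> m" using assms(2,3) by simp
  ultimately have "\<forall>x\<in>L i. \<forall>y\<in>L j. \<not> E x y" using assms(2,3) by blast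
  then show ?thesis using assms(4,5) by blast
qed

lemma levelling_parent:
  assumes "levelling E L m" "Suc i \<le> m" "v \<in> L (Suc i)" shows "\<exists>u\<in>L i. E u v"
proof -
  have "\<forall>i<m. \<forall>v\<in>L (Suc i). \<exists>u\<in>L i. E u v" using assms(1) unfolding levelling_def by (elim conjE)
  then show ?thesis using assms(2,3) by simp
qed

lemma levelling_root: "levelling E L m \<Longrightarrow> \<exists>r. L 0 = {r}"
  unfolding levelling_def by (elim conjE)

context sgraph begin

lemma connI: "(\<And>x. x \<in> S \<Longrightarrow> linked E S x r) \<Longrightarrow> conn E S"
  unfolding conn_def using linked_trans[OF _ linked_sym] by blast

lemma levelling_linked_root:
  assumes "levelling E L m" "L 0 = {r}"
  shows "j \<le> m \<Longrightarrow> x \<in> L j \<Longrightarrow> linked E (below L (Suc j)) x r"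
proof (induction j arbitrary: x)
  case 0
  then show ?case using assms(2) linked_refl by auto
next
  case (Suc j)
  then obtain u where u: "u \<in> L j" "E u x" using levelling_parent[OF assms(1) Suc.prems] by blast
  have "linked E (below L (Suc (Suc j))) u r"
    by (rule linked_mono[OF Suc.IH]) (use u Suc.prems less_Suc_eq in auto)
  moreover have "linked E (below L (Suc (Suc j))) x u"
    by (rule linked_step[OF linked_refl]) (use u Suc.prems symI[of u x] less_Suc_eq in auto)
  ultimately show ?case using linked_trans by blast
qed

lemma conn_below:
  assumes "levelling E L m" "i \<le> Suc m"
  shows "conn E (below L i)"
proof -
  obtain r where r: "L 0 = {r}" using levelling_root[OF assms(1)] by blast
  show ?thesis
  proof (rule connI[of _ r])
    fix x assume "x \<in> below L i"
    then obtain j where j: "j < i" "x \<in> L j" by blast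
    show "linked E (below L i) x r"
    proof (rule linked_mono[OF levelling_linked_root[OF assms(1) r _ j(2)]])
      show "j \<le> m" using j(1) assms(2) by simp
      show "below L (Suc j) \<subseteq> below L i" using j(1) by (intro UN_mono) auto
    qed
  qed
qed

text \<open>Adding one edge at each end keeps the parity, so parities pass between parents and their
  children.\<close>

lemma lift:
  assumes "lnk E X p p' k" "E p u" "E p' u'" "\<And>x. x \<in> X - {p,p'} \<Longrightarrow> \<not> E x u \<and> \<not> E x u'"
    "\<not> E p u'" "\<not> E p' u" "\<not> E u u'" "u \<noteq> u'" "u \<notin> X" "u' \<notin> X" "u \<noteq> p'" "u' \<noteq> p"
  shows "lnk E (insert p (insert p' X)) u u' (k + 2)"
proof -
  have 1: "lnk E (insert p' (X - {p,p'})) p u' (Suc k)"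
    by (rule lnk_snoc[OF lnk_diff[OF assms(1)] assms(3)]) (use assms in auto)
  have "lnk E (insert p (insert p' (X - {p,p'}))) u u' (Suc (Suc k))"
    by (rule lnk_Cons[OF 1]) (use assms symI in auto)
  then show ?thesis by (auto intro: lnk_mono)
qed

lemma lnk3:
  assumes "E a b" "E b c" "E c d" "\<not> E a c" "\<not> E a d" "\<not> E b d" "a \<noteq> c" "a \<noteq> d" "b \<noteq> d"
  shows "lnk E {b,c} a d 3"
  using lnk_Cons[OF lnk2[of b c d], of a] assms irrefl by (auto simp: numeral_eq_Suc)

lemma lnk4:
  assumes "E a b" "E b c" "E c d" "E d e" "\<not> E a c" "\<not> E a d" "\<not> E a e" "\<not> E b d" "\<not> E b e" "\<not> E c e"
    "distinct [a,b,c,d,e]"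
  shows "lnk E {b,c,d} a e 4"
  using lnk_Cons[OF lnk3[of b c d e], of a] assms irrefl by (auto simp: numeral_eq_Suc)

lemma parD: "par E X a b \<epsilon> \<Longrightarrow> lnk E Y a b k \<Longrightarrow> Y \<subseteq> X \<Longrightarrow> (odd k \<longleftrightarrow> \<epsilon>)"
  unfolding par_def using lnk_mono by blast

lemma par_edge: "par E X a b \<epsilon> \<Longrightarrow> E a b \<Longrightarrow> \<epsilon>"
  using parD[OF _ lnk_edge[of a b "{}"]] by auto

text \<open>Otherwise \<open>a, z, b\<close> would be an induced path of length two.\<close>

lemma par_common: "par E X a b True \<Longrightarrow> E a z \<Longrightarrow> E z b \<Longrightarrow> a \<noteq> b \<Longrightarrow> z \<in> X \<Longrightarrow> E a b"
  using parD[OF _ lnk2[of a z b], of X True] by auto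

end

locale spined = sgraph +
  fixes L :: "nat \<Rightarrow> 'a set" and m :: nat and S :: "nat \<Rightarrow> 'a"
  assumes lv: "levelling E L m" and sp: "spine E L S m"
begin

lemma lv_disj: "i \<le> m \<Longrightarrow> j \<le> m \<Longrightarrow> x \<in> L i \<Longrightarrow> x \<in> L j \<Longrightarrow> i = j"
  using levelling_disj[OF lv] .

lemma lv_far: "j \<le> m \<Longrightarrow> i + 2 \<le> j \<Longrightarrow> x \<in> L i \<Longrightarrow> y \<in> L j \<Longrightarrow> \<not> E x y"
  using levelling_far[OF lv] .

lemma lv_parent: "Suc i \<le> m \<Longrightarrow> v \<in> L (Suc i) \<Longrightarrow> \<exists>u\<in>L i. E u v"
  using levelling_parent[OF lv] .

lemma S_in: "i \<le> m \<Longrightarrow> S i \<in> L i" using sp unfolding spine_def by blast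

lemma S_parent: "Suc i \<le> m \<Longrightarrow> u \<in> L i \<Longrightarrow> E u (S (Suc i)) \<longleftrightarrow> u = S i"
  using sp unfolding spine_def by auto

lemma below_far: "Suc i \<le> m \<Longrightarrow> x \<in> below L i \<Longrightarrow> y \<in> L (Suc i) \<Longrightarrow> \<not> E x y"
proof -
  assume a: "Suc i \<le> m" "x \<in> below L i" "y \<in> L (Suc i)"
  then obtain j where "j < i" "x \<in> L j" by blast
  then show ?thesis using lv_far[OF a(1) _ _ a(3), of j] by simp
qed

lemma below_notin: "i \<le> m \<Longrightarrow> y \<in> L i \<Longrightarrow> j \<le> i \<Longrightarrow> y \<notin> below L j"
proof
  assume a: "i \<le> m" "y \<in> L i" "j \<le> i" "y \<in> below L j"
  then obtain l where "l < j" "y \<in> L l" by blast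
  then show False using lv_disj[OF a(1) _ a(2), of l] a by simp
qed

lemma base_path:
  assumes "i \<le> m" "p \<in> L i" "q \<in> L i" "p \<noteq> q"
  shows "\<exists>k. lnk E (below L i) p q k"
proof (cases i)
  case 0
  then show ?thesis using assms levelling_root[OF lv] by auto
next
  case (Suc j)
  obtain u v where "u \<in> L j" "E u p" "v \<in> L j" "E v q" using lv_parent[of j] assms Suc by meson
  then show ?thesis
    using lnk_exists[OF conn_below[OF lv], of i u p v q] assms Suc symI by auto
qed

lemma lift_level:
  assumes "Suc i \<le> m" "lnk E (below L i) p p' k" "p \<in> L i" "p' \<in> L i" "u \<in> L (Suc i)" "u' \<in> L (Suc i)"
    "E p u" "E p' u'" "\<not> E p u'" "\<not> E p' u" "\<not> E u u'" "u \<noteq> u'"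
  shows "lnk E (insert p (insert p' (below L i))) u u' (k + 2)"
proof (rule lift[OF assms(2,7,8)])
  show "\<not> E x u \<and> \<not> E x u'" if "x \<in> below L i - {p,p'}" for x
    using below_far[OF assms(1)] assms(5,6) that by blast
  show "u \<notin> below L i" "u' \<notin> below L i" using below_notin[OF assms(1), of _ i] assms(5,6) by auto
  show "u \<noteq> p'" "u' \<noteq> p" using lv_disj[of i "Suc i"] assms by auto
qed (use assms in auto)

lemma below_Suc: "below L (Suc i) = below L i \<union> L i"
  by (auto simp: less_Suc_eq)

text \<open>Stated with path interiors also through \<open>a\<close>, \<open>b\<close>, \<open>c\<close>, \<open>d\<close> and \<open>S i\<close>, so that the induction passes to
  parents, which may be adjacent.\<close>

definition noP4 :: "nat \<Rightarrow> bool" where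
  "noP4 i \<longleftrightarrow> (\<forall>a b c d \<epsilon>. {a,b,c,d} \<subseteq> L i \<longrightarrow> S i \<notin> {a,b,c,d} \<longrightarrow> distinct [a,b,c,d] \<longrightarrow>
     (let P = par E (below L i \<union> {a,b,c,d,S i}) in
      P a b True \<longrightarrow> P b c True \<longrightarrow> P c d True \<longrightarrow> P a c False \<longrightarrow> P b d False \<longrightarrow> P a d False \<longrightarrow>
      P (S i) a \<epsilon> \<longrightarrow> P (S i) b \<epsilon> \<longrightarrow> P (S i) c \<epsilon> \<longrightarrow> P (S i) d \<epsilon> \<longrightarrow> False))"

text \<open>Two nonadjacent vertices of odd parity have no common parent, and a path below between
  private parents of two vertices has the parity of these two. The contradiction comes from applying
  this to the common parent \<open>p\<close> of \<open>a, c\<close> and to parents \<open>pd\<close>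
  of \<open>d\<close> and \<open>pb\<close> of \<open>b\<close>.\<close>

lemma parents_disjoint:
  assumes i: "Suc i \<le> m" and in': "{a,b,c,d} \<subseteq> L (Suc i)" and dist: "distinct [a,b,c,d]"
    and st: "\<And>x y. {x,y} \<subseteq> {a,b,c,d} \<Longrightarrow> \<not> E x y"
    and P: "par E (below L (Suc i)) a b True" "par E (below L (Suc i)) b c True" "par E (below L (Suc i)) c d True"
      "par E (below L (Suc i)) a c False" "par E (below L (Suc i)) b d False" "par E (below L (Suc i)) a d False"
    and p: "p \<in> L i" "E p a" "E p c"
  shows False
proof -
  note lnkI = lift_level[OF i]
  have sub: "insert x (insert y (below L i)) \<subseteq> below L (Suc i)" if "x \<in> L i" "y \<in> L i" for x y
    using that below_Suc by auto
  have disj: "\<not> E p y" if "par E (below L (Suc i)) x y True" "{x,y} \<subseteq> {a,b,c,d}" "x \<noteq> y" "p \<in> L i" "E p x" for p x y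
    using par_common[OF that(1), of p] that st[of x y] symI[of p] below_Suc by auto
  have odd: "odd k \<longleftrightarrow> \<epsilon>" if "par E (below L (Suc i)) x y \<epsilon>" "{x,y} \<subseteq> {a,b,c,d}" "x \<noteq> y"
    "p \<in> L i" "p' \<in> L i" "E p x" "E p' y" "\<not> E p y" "\<not> E p' x" "lnk E (below L i) p p' k" for x y p p' k \<epsilon>
    using parD[OF that(1) lnkI[OF that(10,4,5), of x y] sub[OF that(4,5)]] that in' st[of x y] by auto
  obtain pd where pd: "pd \<in> L i" "E pd d" using lv_parent[OF i] in' by auto
  obtain pb where pb: "pb \<in> L i" "E pb b" using lv_parent[OF i] in' by auto
  have "\<not> E p d" "\<not> E pd c" using disj[OF P(3)] disj[OF par_sym[OF P(3)]] p pd dist by auto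
  have "\<not> E p b" "\<not> E pb a" using disj[OF P(1)] disj[OF par_sym[OF P(1)]] p pb dist by auto
  \<comment> \<open>Otherwise the path from \<open>p\<close> to \<open>pd\<close> extends both to
    \<open>c, d\<close> and to \<open>a, d\<close>, which have different parities.\<close>
  have "E pd a"
  proof (rule ccontr)
    assume "\<not> E pd a"
    have "p \<noteq> pd" using p \<open>\<not> E pd a\<close> by auto
    then obtain k where k: "lnk E (below L i) p pd k" using base_path[of i] i p pd by auto
    have "odd k" using odd[OF P(3) _ _ p(1) pd(1) p(3) pd(2) \<open>\<not> E p d\<close> \<open>\<not> E pd c\<close> k] dist by auto
    moreover have "\<not> odd k" using odd[OF P(6) _ _ p(1) pd(1) p(2) pd(2) \<open>\<not> E p d\<close> \<open>\<not> E pd a\<close> k] dist by auto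
    ultimately show False by simp
  qed
  have "\<not> E pd b" using disj[OF P(1)] pd \<open>E pd a\<close> dist by auto
  have "pd \<noteq> pb" using \<open>\<not> E pd b\<close> pb by auto
  then obtain k where k: "lnk E (below L i) pd pb k" using base_path[of i] i pb pd by auto
  have "odd k" using odd[OF P(1) _ _ pd(1) pb(1) \<open>E pd a\<close> pb(2) \<open>\<not> E pd b\<close> \<open>\<not> E pb a\<close> k] dist by auto
  show False
  \<comment> \<open>If \<open>pb\<close> misses \<open>d\<close>, the pair \<open>d, b\<close> makes
    the path from \<open>pd\<close> to \<open>pb\<close> even. If not, a path from \<open>p\<close>
    to \<open>pb\<close> serves both the odd pair \<open>a, b\<close> and the even pair
    \<open>a, d\<close>.\<close>
  proof (cases "E pb d")
    case True
    have "pb \<noteq> p" using pb \<open>\<not> E p b\<close> by auto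
    then obtain l where l: "lnk E (below L i) p pb l" using base_path[of i] i p pb by auto
    have "odd l" using odd[OF P(1) _ _ p(1) pb(1) p(2) pb(2) \<open>\<not> E p b\<close> \<open>\<not> E pb a\<close> l] dist by auto
    moreover have "\<not> odd l" using odd[OF P(6) _ _ p(1) pb(1) p(2) True \<open>\<not> E p d\<close> \<open>\<not> E pb a\<close> l] dist by auto
    ultimately show False by simp
  next
    case False
    then have "\<not> odd k"
      using odd[OF par_sym[OF P(5)] _ _ pd(1) pb(1) pd(2) pb(2) \<open>\<not> E pd b\<close> False k] dist by auto
    then show False using \<open>odd k\<close> by simp
  qed
qed

text \<open>No two of \<open>a, b, c, d\<close> have a common parent, so the parents
  \<open>pa, pb, pc, pd\<close> are private, as is the parent \<open>S i\<close> of
  \<open>S (Suc i)\<close>. Paths between them lift to their children without change of parity.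
  Hence the parents repeat the configuration one level down, contrary to
  \<open>noP4 i\<close>.\<close>

lemma noP4_lower:
  assumes IH: "noP4 i"
    and i: "Suc i \<le> m" and in': "{a,b,c,d} \<subseteq> L (Suc i)" and dist: "distinct [a,b,c,d]"
    and st: "\<And>x y. {x,y} \<subseteq> {a,b,c,d} \<Longrightarrow> \<not> E x y"
    and P: "par E (below L (Suc i)) a b True" "par E (below L (Suc i)) b c True" "par E (below L (Suc i)) c d True"
      "par E (below L (Suc i)) a c False" "par E (below L (Suc i)) b d False" "par E (below L (Suc i)) a d False"
    and s: "\<And>x. x \<in> {a,b,c,d} \<Longrightarrow> par E (below L (Suc i)) (S (Suc i)) x \<epsilon>"
    and ns: "\<And>x. x \<in> {a,b,c,d} \<Longrightarrow> x \<noteq> S (Suc i) \<and> \<not> E (S (Suc i)) x \<and> \<not> E (S i) x"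
  shows False
proof -
  have st': "\<And>x y. {x,y} \<subseteq> {d,c,b,a} \<Longrightarrow> \<not> E x y" using st by blast
  have disj1: "\<not> E p y" if "par E (below L (Suc i)) x y True" "{x,y} \<subseteq> {a,b,c,d}" "x \<noteq> y" "p \<in> L i" "E p x" for p x y
    using par_common[OF that(1), of p] that st[of x y] symI[of p] below_Suc by auto
  have ac: "\<not> (E p a \<and> E p c)" if "p \<in> L i" for p
    using parents_disjoint[OF i in' dist st P that] by blast
  \<comment> \<open>The reversed sequence \<open>d, c, b, a\<close> satisfies the same
    hypotheses.\<close>
  have bd: "\<not> (E p b \<and> E p d)" if "p \<in> L i" for p
    using parents_disjoint[OF i _ _ st' P(3,2,1)[THEN par_sym] P(5,4,6)[THEN par_sym] that] in' dist by auto
  obtain pa where pa: "pa \<in> L i" "E pa a" using lv_parent[OF i] in' by auto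
  obtain pb where pb: "pb \<in> L i" "E pb b" using lv_parent[OF i] in' by auto
  obtain pc where pc: "pc \<in> L i" "E pc c" using lv_parent[OF i] in' by auto
  obtain pd where pd: "pd \<in> L i" "E pd d" using lv_parent[OF i] in' by auto
  \<comment> \<open>A path from a common parent of \<open>a\<close> and \<open>d\<close> to
    \<open>pb\<close> would serve both the odd pair \<open>a, b\<close> and the even pair
    \<open>d, b\<close>.\<close>
  have ad: "\<not> (E p a \<and> E p d)" if p0: "p \<in> L i" for p
  proof
    assume p: "E p a \<and> E p d"
    have "\<not> E p b" "\<not> E pb a" "\<not> E pb d"
      using disj1[OF P(1)] disj1[OF par_sym[OF P(1)]] p pb p0 bd[of pb] dist by auto
    moreover have "p \<noteq> pb" using pb \<open>\<not> E p b\<close> by auto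
    then obtain k where k: "lnk E (below L i) p pb k" using base_path[of i] i p0 pb by auto
    have sub: "insert p (insert pb (below L i)) \<subseteq> below L (Suc i)" using p0 pb below_Suc by auto
    have "odd k" using parD[OF P(1) lift_level[OF i k p0 pb(1)] sub] calculation p pb in' st[of a b] dist by auto
    moreover have "\<not> odd k"
      using parD[OF par_sym[OF P(5)] lift_level[OF i k p0 pb(1)] sub] calculation p pb in' st[of d b] dist by auto
    ultimately show False by simp
  qed
  have excl: "\<not> (E p x \<and> E p y)" if "p \<in> L i" "{x,y} \<subseteq> {a,b,c,d}" "x \<noteq> y" for p x y
    using that ac[of p] bd[of p] ad[of p] disj1[OF P(1), of p] disj1[OF P(2), of p] disj1[OF P(3), of p] dist by auto
  \<comment> \<open>The range of interiors used in \<open>noP4 i\<close>: it includes the chosen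
    parents, which may be adjacent to each other.\<close>
  let ?X = "below L i \<union> {pa,pb,pc,pd,S i}"
  have Xsub: "?X \<subseteq> below L (Suc i)" using pa pb pc pd S_in[of i] i below_Suc by auto
  have lift': "par E ?X p p' \<delta>" if "par E (below L (Suc i)) x x' \<delta>" "p \<in> ?X" "p' \<in> ?X" "E p x" "E p' x'"
     "\<And>z. z \<in> ?X - {p} \<Longrightarrow> \<not> E z x" "\<And>z. z \<in> ?X - {p'} \<Longrightarrow> \<not> E z x'" "p \<noteq> p'" "\<not> E x x'" "x \<noteq> x'"
     "x \<in> L (Suc i)" "x' \<in> L (Suc i)" for p p' x x' \<delta>
    unfolding par_def
  proof (intro allI impI)
    fix k assume "lnk E ?X p p' k"
    have nin: "x \<notin> ?X" "x' \<notin> ?X"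
      using Xsub below_notin[OF i, of _ "Suc i"] that(11,12) by blast+
    have "lnk E (insert p (insert p' ?X)) x x' (k + 2)"
      by (rule lift[OF \<open>lnk E ?X p p' k\<close> that(4,5)]) (use that nin in auto)
    then have "odd (k + 2) \<longleftrightarrow> \<delta>" by (rule parD[OF that(1)]) (use Xsub that(2,3) in auto)
    then show "odd k \<longleftrightarrow> \<delta>" by simp
  qed
  have only: "\<not> E z x" if "z \<in> ?X - {p}" "x \<in> {a,b,c,d}" "(x, p) \<in> {(a,pa),(b,pb),(c,pc),(d,pd)}" for z x p
  proof
    assume "E z x"
    then have "z \<notin> below L i" "z \<noteq> S i" using below_far[OF i] that(2) in' ns by auto
    then have "z \<in> {pa,pb,pc,pd} - {p}" using that by auto
    then show False using \<open>E z x\<close> that excl[of z] pa pb pc pd dist by auto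
  qed
  have onlyS: "\<not> E z (S (Suc i))" if "z \<in> ?X - {S i}" for z
    using that below_far[OF i _ S_in[OF i]] S_parent[OF i, of z] pa pb pc pd by auto
  have SS: "E (S i) (S (Suc i))" using S_parent[OF i] S_in[of i] i by auto
  have neS: "S i \<noteq> p" if "E p x" "x \<in> {a,b,c,d}" for p x using that ns by auto
  have dp: "distinct [pa,pb,pc,pd]"
    using excl[of pa a b] excl[of pa a c] excl[of pa a d] excl[of pb b c] excl[of pb b d] excl[of pc c d]
      pa pb pc pd dist by auto
  have parS: "par E ?X (S i) p \<epsilon>" if "(x, p) \<in> {(a,pa),(b,pb),(c,pc),(d,pd)}" "x \<in> {a,b,c,d}" for x p
  proof (rule lift'[OF s[OF that(2)]])
    show "E p x" using that pa pb pc pd dist by auto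
    then show "S i \<noteq> p" using neS that by blast
    show "p \<in> ?X" using that by auto
    show "\<not> E z x" if "z \<in> ?X - {p}" for z using only[OF that] \<open>(x, p) \<in> _\<close> \<open>x \<in> _\<close> by blast
    show "\<not> E z (S (Suc i))" if "z \<in> ?X - {S i}" for z using onlyS that by blast
    show "S (Suc i) \<in> L (Suc i)" "x \<in> L (Suc i)" using S_in[OF i] in' that by auto
  qed (use SS ns[OF that(2)] in auto)
  have pp: "par E ?X p p' \<delta>" if "par E (below L (Suc i)) x x' \<delta>" "(x,p) \<in> {(a,pa),(b,pb),(c,pc),(d,pd)}"
    "(x',p') \<in> {(a,pa),(b,pb),(c,pc),(d,pd)}" "x \<noteq> x'" for x x' p p' \<delta>
  proof (rule lift'[OF that(1)])
    show "E p x" "E p' x'" "p \<in> ?X" "p' \<in> ?X" using that pa pb pc pd by auto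
    show "p \<noteq> p'" using that dp by auto
    show "\<not> E z x" if "z \<in> ?X - {p}" for z using only[OF that, of x] \<open>(x, p) \<in> _\<close> by blast
    show "\<not> E z x'" if "z \<in> ?X - {p'}" for z using only[OF that, of x'] \<open>(x', p') \<in> _\<close> by blast
    show "x \<in> L (Suc i)" "x' \<in> L (Suc i)" "\<not> E x x'" using in' that st[of x x'] by auto
  qed (use that in auto)
  have Sn: "S i \<notin> {pa,pb,pc,pd}" using neS pa pb pc pd by auto
  show False
    using IH[unfolded noP4_def Let_def, rule_format, of pa pb pc pd \<epsilon>] Sn dp
      pp[OF P(1)] pp[OF P(2)] pp[OF P(3)] pp[OF P(4)] pp[OF P(5)] pp[OF P(6)]
      parS[of a pa] parS[of b pb] parS[of c pc] parS[of d pd] pa pb pc pd dist by auto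
qed

end

section \<open>The step from one level to the next, relative to the spine edge
  \<open>q s\<close>\<close>

locale spined_level = spined +
  fixes i :: nat and Y X :: "'a set" and q s :: 'a and \<epsilon> :: bool
  assumes i: "Suc i \<le> m" and Y: "Y \<subseteq> L (Suc i)" and sY: "s \<notin> Y"
    and q_def: "q = S i" and s_def: "s = S (Suc i)" and X_def: "X = below L (Suc i) \<union> (insert s Y)"
    and ps: "\<And>x. x \<in> Y \<Longrightarrow> par E X s x \<epsilon>"
begin

lemma ctx_in: "q \<in> L i" "s \<in> L (Suc i)" "E q s" "E s q"
  using S_in[of i] S_in[of "Suc i"] S_parent[OF i, of q] i sym unfolding q_def s_def by auto

lemma ctx_s: "p \<in> L i \<Longrightarrow> p \<noteq> q \<Longrightarrow> \<not> E p s \<and> \<not> E s p"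
  using S_parent[OF i, of p] symI[of p s] unfolding q_def s_def by simp

lemma ctx_below: "z \<in> below L i \<Longrightarrow> x \<in> insert s Y \<Longrightarrow> \<not> E z x \<and> \<not> E x z"
  using below_far[OF i, of z x] ctx_in(2) Y symI[of z x] by auto

lemma ctx_notin: "x \<in> insert s Y \<Longrightarrow> x \<notin> below L i \<and> x \<notin> L i"
  using below_notin[OF i, of x i] lv_disj[of i "Suc i" x] ctx_in(2) Y i by auto

lemma ctx_sub: "{p,p'} \<subseteq> L i \<Longrightarrow> T \<subseteq> insert s Y \<Longrightarrow> T \<union> insert p (insert p' (below L i)) \<subseteq> X"
  unfolding X_def below_Suc by auto

text \<open>The detour from \<open>s\<close> down to \<open>q\<close>, through the lower levels to a
  parent of \<open>y\<close> and up again. Most contradictions below compare it with a second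
  path.\<close>

lemma ctx_path:
  assumes "p \<in> L i" "E p y" "y \<in> Y" "\<not> E q y" "\<not> E s y"
  obtains k where "lnk E (below L i) q p k" "lnk E (insert q (insert p (below L i))) s y (k + 2)" "odd k \<longleftrightarrow> \<epsilon>"
proof -
  have pq: "p \<noteq> q" using assms by auto
  then obtain k where k: "lnk E (below L i) q p k" using base_path[of i q p] i assms(1) ctx_in(1) by auto
  have l: "lnk E (insert q (insert p (below L i))) s y (k + 2)"
    by (rule lift_level[OF i k ctx_in(1) assms(1)]) (use ctx_in ctx_s[OF assms(1) pq] assms Y sY in auto)
  have "odd (k + 2) \<longleftrightarrow> \<epsilon>"
    by (rule parD[OF ps[OF assms(3)] l]) (use ctx_sub[of q p "{}"] ctx_in assms in auto)
  then show ?thesis using that[OF k l] by simp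
qed

lemma ctx_cross:
  assumes "p \<in> L i" "p' \<in> L i" "E p x" "E p' y" "\<not> E p y" "\<not> E p' x" "x \<in> Y" "y \<in> Y" "\<not> E x y"
    "lnk E (below L i) p p' k"
  shows "lnk E (insert p (insert p' (below L i))) x y (k + 2)"
  by (rule lift_level[OF i assms(10)]) (use assms Y in auto)

lemma ctx_cross_par:
  assumes "par E X x y \<delta>" "p \<in> L i" "p' \<in> L i" "E p x" "E p' y" "\<not> E p y" "\<not> E p' x" "x \<in> Y" "y \<in> Y" "\<not> E x y"
    "lnk E (below L i) p p' k"
  shows "odd k \<longleftrightarrow> \<delta>"
  using parD[OF assms(1) ctx_cross[OF assms(2-11)]] ctx_sub[of p p' "{}"] assms(2,3) by auto

lemma ctx_common:
  assumes "par E X x y True" "p \<in> L i \<union> insert s Y" "E p x" "E p y" "x \<in> Y" "y \<in> Y" "x \<noteq> y"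
  shows "E x y"
  by (rule par_common[OF assms(1), of p]) (use assms symI[of p x] in \<open>auto simp: X_def less_Suc_eq\<close>)

text \<open>If \<open>p\<close> missed \<open>y\<close>, the path from \<open>s\<close> through
  \<open>q\<close> and \<open>p\<close> to \<open>x\<close> could be continued by the edge to
  \<open>y\<close>. This changes its parity, while both paths must have parity
  \<open>\<epsilon>\<close>.\<close>

lemma ctx_parents:
  assumes "x \<in> Y" "y \<in> Y" "E x y" "\<not> E s x" "\<not> E s y" "\<not> E q x" "\<not> E q y" "p \<in> L i" "E p x"
  shows "E p y"
proof (rule ccontr)
  assume "\<not> E p y"
  obtain k where k: "lnk E (insert q (insert p (below L i))) s x (k + 2)" "odd k \<longleftrightarrow> \<epsilon>"
    using ctx_path[OF assms(8,9,1,6,4)] .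
  have "lnk E (insert x (insert q (insert p (below L i)))) s y (Suc (k + 2))"
    by (rule lnk_snoc[OF k(1) assms(3)])
      (use assms \<open>\<not> E p y\<close> ctx_below[of _ y] ctx_notin[of y] sY ctx_in(1) in auto)
  then have "odd (Suc (k + 2)) \<longleftrightarrow> \<epsilon>"
    by (rule parD[OF ps[OF assms(2)]]) (use ctx_sub[of q p "{x}"] ctx_in(1) assms in auto)
  then show False using k(2) by simp
qed

text \<open>\<open>x\<close> and \<open>y\<close> have the same parents, so one path from such a
  parent to a parent of \<open>z\<close> serves both pairs.\<close>

lemma ctx_module:
  assumes "x \<in> Y" "y \<in> Y" "z \<in> Y" "E x y" "\<not> E z x" "\<not> E z y" "x \<noteq> z" "y \<noteq> z"
    "\<And>w. w \<in> {x,y,z} \<Longrightarrow> \<not> E s w \<and> \<not> E q w" "par E X x z True" "par E X y z False"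
  shows False
proof -
  obtain p where p: "p \<in> L i" "E p x" using lv_parent[OF i] assms(1) Y by blast
  obtain p' where p': "p' \<in> L i" "E p' z" using lv_parent[OF i] assms(3) Y by blast
  have py: "E p y" using ctx_parents[of x y p] assms p by auto
  have n: "\<not> E t z" if "t \<in> L i" "E t x" for t
    using ctx_common[OF assms(10), of t] that assms symI[of z x] by auto
  have "\<not> E p' x" using n[of p'] p' by auto
  moreover have "\<not> E p' y" using ctx_parents[of y x p'] assms p' \<open>\<not> E p' x\<close> sym by auto
  moreover have "p \<noteq> p'" using \<open>\<not> E p' x\<close> p by auto
  then obtain k where k: "lnk E (below L i) p p' k" using base_path[of i] i p p' by auto
  ultimately have "odd k" "\<not> odd k"
    using ctx_cross_par[OF assms(10) p(1) p'(1) p(2) p'(2) n[OF p] _ _ _ _ k]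
      ctx_cross_par[OF assms(11) p(1) p'(1) py p'(2) n[OF p] _ _ _ _ k] assms symI[of z] by auto
  then show False by simp
qed

text \<open>By \<open>ctx_module\<close> the edges \<open>a b\<close>, \<open>b c\<close>,
  \<open>c d\<close> are all present or all absent. If present, they form a path of length 3 between
  the even pair \<open>a, d\<close>; if absent, the four vertices are stable and
  \<open>noP4_lower\<close> applies.\<close>

lemma ctx_off_spine:
  assumes "noP4 i" "{a,b,c,d} \<subseteq> Y" "distinct [a,b,c,d]"
    "\<And>x. x \<in> {a,b,c,d} \<Longrightarrow> \<not> E s x \<and> \<not> E q x"
    and P: "par E X a b True" "par E X b c True" "par E X c d True"
     "par E X a c False" "par E X b d False" "par E X a d False"
  shows False
proof -
  have n: "\<not> E a c" "\<not> E b d" "\<not> E a d" "\<not> E c a" "\<not> E d b" "\<not> E d a"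
    using P(4-6)[THEN par_edge] P(4-6)[THEN par_sym, THEN par_edge] by auto
  have e1: "E a b \<Longrightarrow> E b c"
    using ctx_module[of b a c] P n assms(2-4) sym[of a b] par_sym symI[of c b] by auto
  have e2: "E b c \<Longrightarrow> E c d"
    using ctx_module[of c b d] P n assms(2-4) sym[of b c] par_sym symI[of d c] by auto
  have e3: "E b c \<Longrightarrow> E a b"
    using ctx_module[of b c a] P n assms(2-4) par_sym by auto
  have e4: "E c d \<Longrightarrow> E b c"
    using ctx_module[of c d b] P n assms(2-4) par_sym by auto
  show False
  proof (cases "E b c")
    case True
    then have "lnk E {b,c} a d 3" using lnk3[of a b c d] e2 e3 n assms(3) by auto
    then have "odd (3::nat) \<longleftrightarrow> False" by (rule parD[OF P(6)]) (use assms(2) X_def in auto)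
    then show False by simp
  next
    case False
    then have ne: "\<not> E a b" "\<not> E b c" "\<not> E c d" "\<not> E b a" "\<not> E c b" "\<not> E d c"
      using e1 e4 symI[of b a] symI[of c b] symI[of d c] by auto
    have sub: "below L (Suc i) \<subseteq> X" unfolding X_def by blast
    show False
    proof (rule noP4_lower[OF assms(1) i _ assms(3) _ P[THEN par_mono, OF sub]])
      show "{a, b, c, d} \<subseteq> L (Suc i)" using assms(2) Y by blast
      show "\<not> E x y" if "{x, y} \<subseteq> {a, b, c, d}" for x y using that n ne irrefl by auto
      show "par E (below L (Suc i)) (S (Suc i)) x \<epsilon>" if "x \<in> {a, b, c, d}" for x
        using par_mono[OF ps sub] that assms(2) unfolding s_def by blast
      show "x \<noteq> S (Suc i) \<and> \<not> E (S (Suc i)) x \<and> \<not> E (S i) x" if "x \<in> {a, b, c, d}" for x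
        using assms(2) assms(4)[OF that] that sY unfolding s_def q_def by blast
    qed
  qed
qed

lemma ctx_ne: "x \<in> Y \<Longrightarrow> s \<noteq> x \<and> q \<noteq> x \<and> x \<noteq> s \<and> x \<noteq> q \<and> q \<noteq> s \<and> s \<noteq> q"
  using sY ctx_notin[of x] ctx_in(1,3) irrefl by auto

lemma ctx_inX: "insert s (insert q Y) \<subseteq> X" "p \<in> L i \<Longrightarrow> p \<in> X"
  using ctx_in(1) unfolding X_def below_Suc by auto

lemma ctx_parD: "x \<in> Y \<Longrightarrow> lnk E T s x k \<Longrightarrow> T \<subseteq> X \<Longrightarrow> (odd k \<longleftrightarrow> \<epsilon>)"
  using parD[OF ps] .

lemma no_path3:
  assumes "par E X w z False" "E w x" "E x y" "E y z" "\<not> E w y" "\<not> E x z" "{w,x,y,z} \<subseteq> insert q (insert s Y)"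
    "w \<noteq> y" "w \<noteq> z" "x \<noteq> z"
  shows False
proof -
  have "\<not> E w z" using par_edge[OF assms(1)] by blast
  then have "lnk E {x,y} w z 3" using lnk3 assms by blast
  then have "odd (3::nat) \<longleftrightarrow> False" by (rule parD[OF assms(1)]) (use assms(7) ctx_inX(1) in auto)
  then show False by simp
qed

text \<open>No vertex of \<open>Y\<close> is adjacent to \<open>s\<close>, as an edge is odd. If
  \<open>x\<close> and \<open>y\<close> are adjacent, \<open>s, q, x, y\<close> is an odd path. If
  not, no parent of \<open>y\<close> is adjacent to \<open>x\<close>, and a path from
  \<open>q\<close> to a parent of \<open>y\<close> is even because of \<open>s, y\<close> and odd
  because of \<open>x, y\<close>.\<close>

lemma even_cross:
  assumes "\<not> \<epsilon>" "x \<in> Y" "y \<in> Y" "E q x" "\<not> E q y" "par E X x y True"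
  shows False
proof -
  have ns: "\<not> E s x" "\<not> E s y" using par_edge[OF ps] assms(1-3) by auto
  have xy: "\<not> E x y"
  proof
    assume "E x y"
    then have "lnk E {q,x} s y 3" using lnk3[of s q x y] assms ns ctx_in ctx_ne[of x] ctx_ne[of y] by auto
    then have "odd (3::nat) \<longleftrightarrow> \<epsilon>" by (rule ctx_parD[OF assms(3)]) (use ctx_inX(1) assms(2) in auto)
    then show False using assms(1) by simp
  qed
  have ne: "x \<noteq> y" using assms(4,5) by auto
  obtain p where p: "p \<in> L i" "E p y" using lv_parent[OF i] assms(3) Y by blast
  obtain k where k: "lnk E (below L i) q p k" "odd k \<longleftrightarrow> \<epsilon>"
    using ctx_path[OF p assms(3,5) ns(2)] by blast
  show False
  proof (cases "E p x")
    case True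
    then show False using ctx_common[OF assms(6) _ True p(2)] p(1) assms(2,3) ne xy by auto
  next
    case False
    then show False
      using ctx_cross_par[OF assms(6) ctx_in(1) p(1) assms(4) p(2) assms(5) False assms(2,3) xy k(1)] k(2) assms(1)
      by simp
  qed
qed

text \<open>By \<open>even_cross\<close>, \<open>q\<close> is adjacent to all four vertices or to
  none. If to all, this common neighbour turns the odd pairs into edges, which form a path of length
  3 between \<open>a\<close> and \<open>d\<close>.\<close>

lemma even_case:
  assumes "\<not> \<epsilon>" "noP4 i" and sub: "{a,b,c,d} \<subseteq> Y" and dist: "distinct [a,b,c,d]"
    and P: "par E X a b True" "par E X b c True" "par E X c d True"
     "par E X a c False" "par E X b d False" "par E X a d False"
  shows False
proof -
  note Ps = P[THEN par_sym]
  have ns: "\<not> E s x" if "x \<in> Y" for x using par_edge[OF ps[OF that]] assms(1) by blast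
  have q: "E q a \<longleftrightarrow> E q b" "E q b \<longleftrightarrow> E q c" "E q c \<longleftrightarrow> E q d"
    using even_cross[OF assms(1)] P(1-3) Ps(1-3) sub by blast+
  show False
  proof (cases "E q a")
    case True
    have inL: "q \<in> L i \<union> insert s Y" using ctx_in(1) by blast
    have e: "E a b" "E b c" "E c d"
      using ctx_common[OF P(1) inL] ctx_common[OF P(2) inL] ctx_common[OF P(3) inL] True q sub dist by auto
    have "\<not> E a c" "\<not> E b d" using P(4,5)[THEN par_edge] by auto
    then show False using no_path3[OF P(6) e] sub dist by auto
  next
    case False
    then show False using ctx_off_spine[OF assms(2) sub dist _ P] q ns sub by auto
  qed
qed

section \<open>Odd parity to the end of the spine\<close>

lemma odd_off:
  assumes "\<epsilon>" "y \<in> Y" "\<not> E s y"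
  shows "\<not> E q y"
proof
  assume "E q y"
  then have "lnk E {q} s y 2" using lnk2[of s q y] assms ctx_in ctx_ne[of y] by auto
  then have "odd (2::nat) \<longleftrightarrow> \<epsilon>" by (rule ctx_parD[OF assms(2)]) (use ctx_inX(1) in auto)
  then show False using assms(1) by simp
qed

text \<open>An edge would make \<open>s, x, y\<close> an induced path of length two, against the odd
  parity of \<open>s, y\<close>.\<close>

lemma odd_nonadj:
  assumes "\<epsilon>" "x \<in> Y" "y \<in> Y" "E s x" "\<not> E s y"
  shows "\<not> E x y" "\<not> E y x" "x \<noteq> y"
proof -
  show "\<not> E x y"
  proof
    assume "E x y"
    then have "lnk E {x} s y 2" using lnk2[of s x y] assms ctx_ne[of y] by auto
    then have "odd (2::nat) \<longleftrightarrow> \<epsilon>" by (rule ctx_parD[OF assms(3)]) (use ctx_inX(1) assms(2) in auto)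
    then show False using assms(1) by simp
  qed
  then show "\<not> E y x" using sym by blast
  show "x \<noteq> y" using assms by auto
qed

text \<open>A common neighbour \<open>p\<close> would force an edge. If \<open>q\<close> missed
  \<open>e\<close>, prefixing \<open>e\<close> to the odd path from \<open>s\<close> through
  \<open>q\<close> and \<open>p\<close> to \<open>w\<close> would give an even path for the odd pair
  \<open>e, w\<close>.\<close>

lemma odd_true:
  assumes "\<epsilon>" "e \<in> Y" "w \<in> Y" "E s e" "\<not> E s w" "par E X e w True" "p \<in> L i" "E p w"
  shows "\<not> E p e" "E q e"
proof -
  note n = odd_nonadj[OF assms(1-5)] odd_off[OF assms(1,3,5)]
  show pe: "\<not> E p e" using ctx_common[OF assms(6), of p] assms n by auto
  show "E q e"
  proof (rule ccontr)
    assume nq: "\<not> E q e"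
    obtain k where k: "lnk E (insert q (insert p (below L i))) s w (k + 2)" "odd k \<longleftrightarrow> \<epsilon>"
      using ctx_path[OF assms(7,8,3) n(4) assms(5)] by blast
    have "lnk E (insert s (insert q (insert p (below L i)))) e w (Suc (k + 2))"
      by (rule lnk_Cons[OF k(1)])
        (use assms n pe nq ctx_below[of _ e] ctx_notin[of e] ctx_in(1) sym[of s e] symI[of e] in auto)
    then have "odd (Suc (k + 2)) \<longleftrightarrow> True"
      by (rule parD[OF assms(6)]) (use ctx_sub[of q p "{s}"] ctx_in(1) assms in auto)
    then show False using k(2) assms(1) by simp
  qed
qed

text \<open>Otherwise the path from \<open>q\<close> to \<open>p\<close>, odd because of
  \<open>s, w\<close>, would also extend to the even pair \<open>e, w\<close>.\<close>

lemma odd_false: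
  assumes "\<epsilon>" "e \<in> Y" "w \<in> Y" "E s e" "\<not> E s w" "par E X e w False" "p \<in> L i" "E p w" "E q e"
  shows "E p e"
proof (rule ccontr)
  assume pe: "\<not> E p e"
  note n = odd_nonadj[OF assms(1-5)] odd_off[OF assms(1,3,5)]
  obtain k where k: "lnk E (below L i) q p k" "odd k \<longleftrightarrow> \<epsilon>"
    using ctx_path[OF assms(7,8,3) n(4) assms(5)] by blast
  show False
    using ctx_cross_par[OF assms(6) ctx_in(1) assms(7,9,8) n(4) pe assms(2,3) n(1) k(1)] k(2) assms(1) by simp
qed

text \<open>By \<open>odd_true\<close> and \<open>odd_false\<close> all parents of \<open>w\<close>,
  but none of \<open>v\<close>, are adjacent to \<open>e\<close>. So \<open>e, p', ..., p, v\<close>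
  is an odd path, and the edge from \<open>s\<close> to \<open>e\<close> prolongs it to an even path
  from \<open>s\<close> to \<open>v\<close>.\<close>

lemma odd_module:
  assumes e: "\<epsilon>" "e \<in> Y" "v \<in> Y" "w \<in> Y" "E s e" "\<not> E s v" "\<not> E s w"
    and P: "par E X e v True" "par E X e w False"
  shows False
proof -
  obtain p where p: "p \<in> L i" "E p v" using lv_parent[OF i] e(3) Y by blast
  obtain p' where p': "p' \<in> L i" "E p' w" using lv_parent[OF i] e(4) Y by blast
  have pe: "\<not> E p e" "E q e" using odd_true[OF e(1,2,3,5,6) P(1) p] by auto
  have all: "E t e" if "t \<in> L i" "E t w" for t using odd_false[OF e(1,2,4,5,7) P(2) that pe(2)] .
  have p'e: "E p' e" using all p' .
  have p'v: "\<not> E p' v" using odd_true(1)[OF e(1,2,3,5,6) P(1) p'(1)] p'e by blast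
  have ne: "p' \<noteq> p" using pe(1) p'e by auto
  note nv = odd_nonadj[OF e(1,2,3,5,6)] odd_off[OF e(1,3,6)]
  note nw = odd_off[OF e(1,4,7)]
  obtain l where l: "lnk E (below L i) p' p l" using base_path[of i p' p] i p p' ne by auto
  have c: "lnk E (insert p' (insert p (below L i))) e v (l + 2)"
    by (rule ctx_cross[OF p'(1) p(1) p'e p(2) p'v pe(1) e(2,3) nv(1) l])
  have "odd (l + 2) \<longleftrightarrow> True" by (rule parD[OF P(1) c]) (use ctx_sub[of p' p "{}"] p p' in auto)
  moreover have "p \<noteq> q" "p' \<noteq> q" using nv(4) nw p p' by auto
  then have "lnk E (insert e (insert p' (insert p (below L i)))) s v (Suc (l + 2))"
    by (intro lnk_Cons[OF c e(5)])
      (use e ctx_s[of p] ctx_s[of p'] p p' ctx_below[of _ s] ctx_notin[of s] ctx_ne[of v] in auto)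
  then have "odd (Suc (l + 2)) \<longleftrightarrow> \<epsilon>"
    by (rule ctx_parD[OF e(3)]) (use ctx_sub[of p' p "{e}"] p p' e in auto)
  ultimately show False using e(1) by simp
qed

lemma odd_adj:
  assumes "x \<in> Y" "y \<in> Y" "E s x" "E s y" "x \<noteq> y" "par E X x y True"
  shows "E x y"
  using ctx_common[OF assms(6), of s] assms by auto

text \<open>The exceptional vertex \<open>w\<close> is an end of the sequence
  \<open>w, x, y, z\<close> of odd pairs. Of \<open>x, y, z\<close> only \<open>x\<close> is
  adjacent to \<open>q\<close> and none to the parent \<open>p\<close> of \<open>w\<close>, so
  \<open>z, y, x, q, ..., p, w\<close> is an odd induced path for the even pair
  \<open>w, z\<close>.\<close>

lemma odd_end:
  assumes e: "\<epsilon>" "{w,x,y,z} \<subseteq> Y" "distinct [w,x,y,z]" "\<not> E s w" "E s x" "E s y" "E s z"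
    and P: "par E X w x True" "par E X w y False" "par E X w z False" "par E X x y True" "par E X y z True" "par E X x z False"
  shows False
proof -
  have Y4: "w \<in> Y" "x \<in> Y" "y \<in> Y" "z \<in> Y" using e(2) by auto
  note nx = odd_nonadj[OF e(1) Y4(2,1) e(5,4)] and ny = odd_nonadj[OF e(1) Y4(3,1) e(6,4)]
    and nz = odd_nonadj[OF e(1) Y4(4,1) e(7,4)]
  have xy: "E x y" "E y x" using odd_adj[OF _ _ _ _ _ P(4)] e sym by auto
  have yz: "E y z" "E z y" using odd_adj[OF _ _ _ _ _ P(5)] e sym by auto
  have xz: "\<not> E x z" "\<not> E z x" using par_edge[OF P(6)] sym by blast+
  have wq: "\<not> E q w" using odd_off[OF e(1) Y4(1) e(4)] .
  obtain p where p: "p \<in> L i" "E p w" using lv_parent[OF i] Y4(1) Y by blast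
  have pq: "p \<noteq> q" using wq p by auto
  have ps': "\<not> E p s" using ctx_s[OF p(1) pq] by blast
  have px: "\<not> E p x" "E q x" using odd_true[OF e(1) Y4(2,1) e(5,4) par_sym[OF P(1)] p] by auto
  have pne: "p \<noteq> w" "p \<noteq> x" "p \<noteq> y" "p \<noteq> z" "p \<noteq> s"
    using p(1) ctx_notin[of w] ctx_notin[of x] ctx_notin[of y] ctx_notin[of z] ctx_notin[of s] Y4 by auto
  have pz: "\<not> E p z"
  proof
    assume "E p z"
    then have "lnk E {p,z,s} w x 4"
      using lnk4[of w p z s x] p px e xz ps' pne nx nz ctx_ne[of w] ctx_ne[of x] ctx_ne[of z] Y4
        sym[of p w] sym[of s z] symI[of w s] by auto
    then have "odd (4::nat) \<longleftrightarrow> True" by (rule parD[OF P(1)]) (use p Y4 ctx_inX in auto)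
    then show False by simp
  qed
  have py: "\<not> E p y"
  proof
    assume "E p y"
    then have "lnk E {p,y} w z 3"
      using lnk3[of w p y z] p pz yz nz ny pne e(3) sym[of p w] by auto
    then have "odd (3::nat) \<longleftrightarrow> False" by (rule parD[OF P(3)]) (use p Y4 ctx_inX in auto)
    then show False by simp
  qed
  have qy: "\<not> E q y" using odd_false[OF e(1) Y4(3,1) e(6,4) par_sym[OF P(2)] p] py by blast
  have qz: "\<not> E q z" using odd_false[OF e(1) Y4(4,1) e(7,4) par_sym[OF P(3)] p] pz by blast
  obtain k where k: "lnk E (below L i) q p k" "odd k \<longleftrightarrow> \<epsilon>"
    using ctx_path[OF p Y4(1) wq e(4)] by blast
  let ?B = "insert q (insert p (below L i))"
  have 1: "lnk E ?B x w (k + 2)"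
    by (rule ctx_cross[OF ctx_in(1) p(1) px(2) p(2) wq px(1) Y4(2,1) nx(1) k(1)])
  have 2: "lnk E (insert x ?B) y w (Suc (k + 2))"
    by (rule lnk_Cons[OF 1 xy(2) ny(1,3)])
      (use qy py symI[of y] ctx_below[of _ y] Y4 ctx_notin[of y] ctx_in(1) p(1) in auto)
  have "lnk E (insert y (insert x ?B)) z w (Suc (Suc (k + 2)))"
    by (rule lnk_Cons[OF 2 yz(2) nz(1,3)])
      (use qz pz xz e(3) symI[of z] ctx_below[of _ z] Y4 ctx_notin[of z] ctx_in(1) p(1) in auto)
  then have "odd (Suc (Suc (k + 2))) \<longleftrightarrow> False"
    by (rule parD[OF par_sym[OF P(3)]]) (use ctx_sub[of q p "{x,y}"] Y4 ctx_in(1) p(1) in auto)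
  then show False using k(2) e(1) by simp
qed

text \<open>The exceptional vertex \<open>w\<close> is inner in the sequence
  \<open>x, w, y, z\<close> of odd pairs. Here \<open>q\<close> is adjacent to \<open>x\<close> and
  \<open>y\<close> but not to \<open>z\<close>, so \<open>x, q, y, z\<close> is a path of length 3
  for the even pair \<open>x, z\<close>.\<close>

lemma odd_inner:
  assumes e: "\<epsilon>" "{w,x,y,z} \<subseteq> Y" "distinct [w,x,y,z]" "\<not> E s w" "E s x" "E s y" "E s z"
    and P: "par E X x w True" "par E X w y True" "par E X y z True" "par E X x y False" "par E X w z False" "par E X x z False"
  shows False
proof -
  have Y4: "w \<in> Y" "x \<in> Y" "y \<in> Y" "z \<in> Y" using e(2) by auto
  note nx = odd_nonadj[OF e(1) Y4(2,1) e(5,4)] and nz = odd_nonadj[OF e(1) Y4(4,1) e(7,4)]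
  have yz: "E y z" using odd_adj[OF _ _ _ _ _ P(3)] e by auto
  have xz: "\<not> E x z" "\<not> E z x" "\<not> E x y" using par_edge[OF P(6)] par_edge[OF P(4)] sym by blast+
  have wq: "\<not> E q w" using odd_off[OF e(1) Y4(1) e(4)] .
  obtain p where p: "p \<in> L i" "E p w" using lv_parent[OF i] Y4(1) Y by blast
  have pq: "p \<noteq> q" using wq p by auto
  have ps': "\<not> E p s" using ctx_s[OF p(1) pq] by blast
  have px: "\<not> E p x" "E q x" using odd_true[OF e(1) Y4(2,1) e(5,4) P(1) p] by auto
  have py: "\<not> E p y" "E q y" using odd_true[OF e(1) Y4(3,1) e(6,4) par_sym[OF P(2)] p] by auto
  have pne: "p \<noteq> w" "p \<noteq> x" "p \<noteq> y" "p \<noteq> z" "p \<noteq> s"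
    using p(1) ctx_notin[of w] ctx_notin[of x] ctx_notin[of y] ctx_notin[of z] ctx_notin[of s] Y4 by auto
  have pz: "\<not> E p z"
  proof
    assume "E p z"
    then have "lnk E {p,z,s} w x 4"
      using lnk4[of w p z s x] p px e xz ps' pne nx nz ctx_ne[of w] ctx_ne[of x] ctx_ne[of z] Y4
        sym[of p w] sym[of s z] symI[of w s] by auto
    then have "odd (4::nat) \<longleftrightarrow> True" by (rule parD[OF par_sym[OF P(1)]]) (use p Y4 ctx_inX in auto)
    then show False by simp
  qed
  have qz: "\<not> E q z" using odd_false[OF e(1) Y4(4,1) e(7,4) par_sym[OF P(5)] p] pz by blast
  show False
    using no_path3[OF P(6) sym[OF px(2)] py(2) yz xz(3) qz] e(3) Y4 ctx_ne[of z] by auto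
qed

lemma odd_case:
  assumes e: "\<epsilon>" "noP4 i" and sub: "{a,b,c,d} \<subseteq> Y" and dist: "distinct [a,b,c,d]"
    and P: "par E X a b True" "par E X b c True" "par E X c d True"
     "par E X a c False" "par E X b d False" "par E X a d False"
  shows False
proof -
  note Ps = P[THEN par_sym]
  have Y4: "a \<in> Y" "b \<in> Y" "c \<in> Y" "d \<in> Y" using sub by auto
  \<comment> \<open>None, all, or all but one of the vertices are adjacent to \<open>s\<close> in
    the first six cases. Each later case has an \<open>e\<close> adjacent to \<open>s\<close> and
    two vertices not adjacent to \<open>s\<close>, one odd and one even to \<open>e\<close>, as
    \<open>odd_module\<close> needs; together they cover every remaining pattern.\<close>
  consider "\<not> E s a" "\<not> E s b" "\<not> E s c" "\<not> E s d"
    | "E s a" "E s b" "E s c" "E s d"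
    | "\<not> E s a" "E s b" "E s c" "E s d" | "E s a" "\<not> E s b" "E s c" "E s d"
    | "E s a" "E s b" "\<not> E s c" "E s d" | "E s a" "E s b" "E s c" "\<not> E s d"
    | "\<not> E s a" "\<not> E s b" "E s c" | "\<not> E s a" "\<not> E s c" "E s d" | "\<not> E s a" "\<not> E s d" "E s b"
    | "\<not> E s b" "\<not> E s c" "E s a" | "\<not> E s b" "\<not> E s d" "E s a" | "\<not> E s c" "\<not> E s d" "E s b"
    by argo
  then show False
  proof cases
    case 1
    then show False using ctx_off_spine[OF e(2) sub dist _ P] odd_off[OF e(1)] Y4 by blast
  next
    case 2
    have "E a b" "E b c" "E c d" using odd_adj P(1-3) 2 Y4 dist by auto
    moreover have "\<not> E a c" "\<not> E b d" using P(4,5)[THEN par_edge] by auto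
    ultimately show False using no_path3[OF P(6)] sub dist by auto
  next
    case 3 then show False using odd_end[OF e(1), of a b c d] P sub dist by blast
  next
    case 4 then show False using odd_inner[OF e(1), of b a c d] P sub dist by auto
  next
    case 5 then show False using odd_inner[OF e(1), of c d b a] Ps sub dist by auto
  next
    case 6 then show False using odd_end[OF e(1), of d c b a] Ps sub dist by auto
  next
    case 7 then show False using odd_module[OF e(1) Y4(3,2,1)] Ps by blast
  next
    case 8 then show False using odd_module[OF e(1) Y4(4,3,1)] Ps by blast
  next
    case 9 then show False using odd_module[OF e(1) Y4(2,1,4)] Ps P by blast
  next
    case 10 then show False using odd_module[OF e(1) Y4(1,2,3)] P by blast
  next
    case 11 then show False using odd_module[OF e(1) Y4(1,2,4)] P by blast
  next
    case 12 then show False using odd_module[OF e(1) Y4(2,3,4)] P by blast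
  qed
qed

end

context spined begin

lemma noP4_all: "i \<le> m \<Longrightarrow> noP4 i"
proof (induction i)
  case 0
  obtain r where "L 0 = {r}" using levelling_root[OF lv] by blast
  then show ?case unfolding noP4_def by auto
next
  case (Suc i)
  show ?case unfolding noP4_def Let_def
  proof (intro allI impI)
    fix a b c d :: 'a and \<epsilon> :: bool
    let ?Y = "{a,b,c,d}" let ?X = "below L (Suc i) \<union> {a,b,c,d,S (Suc i)}"
    assume sub: "?Y \<subseteq> L (Suc i)" "S (Suc i) \<notin> ?Y" "distinct [a,b,c,d]"
      and P: "par E ?X a b True" "par E ?X b c True" "par E ?X c d True"
        "par E ?X a c False" "par E ?X b d False" "par E ?X a d False"
      and Q: "par E ?X (S (Suc i)) a \<epsilon>" "par E ?X (S (Suc i)) b \<epsilon>" "par E ?X (S (Suc i)) c \<epsilon>" "par E ?X (S (Suc i)) d \<epsilon>"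
    interpret spined_level E L m S i ?Y ?X "S i" "S (Suc i)" \<epsilon>
      by unfold_locales (use Suc.prems sub Q in auto)
    have "noP4 i" using Suc by simp
    then show False
      using even_case[OF _ _ _ sub(3) P] odd_case[OF _ _ _ sub(3) P] by blast
  qed
qed

text \<open>A path from \<open>S i\<close> to a parent of \<open>y\<close> extends to the even pair
  \<open>S (Suc i), y\<close> and, if \<open>S i\<close> were a parent of \<open>x\<close>, also to
  the odd pair \<open>x, y\<close>.\<close>

lemma top_pair:
  assumes i: "Suc i \<le> m" and xy: "{x,y} \<subseteq> L (Suc i)" "S (Suc i) \<notin> {x,y}" "x \<noteq> y"
    and st: "\<not> E x y" "\<not> E (S (Suc i)) x" "\<not> E (S (Suc i)) y"
    and P: "par E (below L (Suc i)) x y True" and e: "par E (below L (Suc i)) (S (Suc i)) y False"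
  shows "\<not> E (S i) x"
proof
  let ?q = "S i" and ?s = "S (Suc i)"
  assume qx: "E ?q x"
  have q: "?q \<in> L i" "E ?q ?s" using S_in[of i] S_parent[OF i, of ?q] i by auto
  have qb: "L i \<subseteq> below L (Suc i)" unfolding below_Suc by blast
  have qy: "\<not> E ?q y"
    using par_common[OF P, of ?q] qx q qb st(1) xy(3) sym[of ?q x] by blast
  obtain p where p: "p \<in> L i" "E p y" using lv_parent[OF i] xy by blast
  have px: "\<not> E p x" using par_common[OF P, of p] p qb st(1) xy(3) sym[of p x] by blast
  have ne: "?q \<noteq> p" using qy p by auto
  obtain k where k: "lnk E (below L i) ?q p k" using base_path[of i ?q p] i q p ne by auto
  have sub: "insert ?q (insert p (below L i)) \<subseteq> below L (Suc i)" unfolding below_Suc using q p by auto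
  have "lnk E (insert ?q (insert p (below L i))) ?s y (k + 2)"
    by (rule lift_level[OF i k q(1) p(1)]) (use S_in[OF i] S_parent[OF i p(1)] ne q p qy st xy in auto)
  then have "odd (k + 2) \<longleftrightarrow> False" by (rule parD[OF e]) (rule sub)
  moreover have "lnk E (insert ?q (insert p (below L i))) x y (k + 2)"
    by (rule lift_level[OF i k q(1) p(1)]) (use q p qy px qx st xy in auto)
  then have "odd (k + 2) \<longleftrightarrow> True" by (rule parD[OF P]) (rule sub)
  ultimately show False by simp
qed

text \<open>\<open>noP4 m\<close> does not apply, since parities are given only for paths through
  the levels below. But the vertices are stable, so it suffices that the spine vertex one level down
  misses all of \<open>a, b, c, d\<close>; then \<open>noP4_lower\<close> applies.\<close>

lemma top_P4:
  assumes sub: "{a,b,c,d} \<subseteq> L m" "S m \<notin> {a,b,c,d}" "distinct [a,b,c,d]"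
    and st: "\<And>x y. {x,y} \<subseteq> {a,b,c,d,S m} \<Longrightarrow> \<not> E x y"
    and P: "par E (below L m) a b True" "par E (below L m) b c True" "par E (below L m) c d True"
      "par E (below L m) a c False" "par E (below L m) b d False" "par E (below L m) a d False"
    and Q: "\<And>x. x \<in> {a,b,c,d} \<Longrightarrow> par E (below L m) (S m) x \<epsilon>"
  shows False
proof (cases m)
  case 0
  then show False using levelling_root[OF lv] sub by auto
next
  case (Suc i)
  have i: "Suc i \<le> m" using Suc by simp
  have q: "S i \<in> L i" "E (S i) (S (Suc i))" using S_in[of i] S_parent[OF i, of "S i"] Suc by auto
  have off: "\<not> E (S i) x" if x: "x \<in> {a,b,c,d}" for x
  proof (cases \<epsilon>)
    case True
    show ?thesis
    proof
      assume "E (S i) x"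
      then have "E (S m) x"
        using par_common[of "below L m" "S m" x "S i"] Q[OF x] True q Suc sym[of "S i" "S m"] sub(2) x
        by (auto simp: less_Suc_eq)
      then show False using st[of "S m" x] x by auto
    qed
  next
    case False
    note t = top_pair[OF i, folded Suc]
    have Q': "par E (below L m) (S m) y False" if "y \<in> {a,b,c,d}" for y using Q[OF that] False by simp
    have "\<not> E (S i) a" using t[of a b] sub st P Q'[of b] by auto
    moreover have "\<not> E (S i) b" using t[of b a] sub st par_sym[OF P(1)] Q'[of a] by auto
    moreover have "\<not> E (S i) c" using t[of c d] sub st P Q'[of d] by auto
    moreover have "\<not> E (S i) d" using t[of d c] sub st par_sym[OF P(3)] Q'[of c] by auto
    ultimately show ?thesis using x by blast
  qed
  show False
  proof (rule noP4_lower[OF noP4_all i _ sub(3) _ P[unfolded Suc]])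
    show "i \<le> m" using i by simp
    show "{a, b, c, d} \<subseteq> L (Suc i)" using sub Suc by simp
    show "\<not> E x y" if "{x,y} \<subseteq> {a,b,c,d}" for x y using st[of x y] that by blast
    show "par E (below L (Suc i)) (S (Suc i)) x \<epsilon>" if "x \<in> {a,b,c,d}" for x using Q[OF that] Suc by simp
    show "x \<noteq> S (Suc i) \<and> \<not> E (S (Suc i)) x \<and> \<not> E (S i) x" if "x \<in> {a,b,c,d}" for x
      using sub(2) st[of "S m" x] off[OF that] that Suc by auto
  qed
qed

end

section \<open>Minimal covers and the construction of a spine\<close>

lemma minimal_cover:
  assumes "finite C" "\<forall>v\<in>A. \<exists>u\<in>C. E u v"
  shows "\<exists>C'\<subseteq>C. (\<forall>v\<in>A. \<exists>u\<in>C'. E u v) \<and> (\<forall>c\<in>C'. \<exists>v\<in>A. \<forall>u\<in>C'. E u v \<longleftrightarrow> u = c)"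
  using assms
proof (induction C rule: finite_psubset_induct)
  case (psubset C)
  show ?case
  proof (cases "\<forall>c\<in>C. \<exists>v\<in>A. \<forall>u\<in>C. E u v \<longleftrightarrow> u = c")
    case True
    then show ?thesis using psubset.prems by (intro exI[of _ C]) auto
  next
    case False
    then obtain c where c: "c \<in> C" "\<forall>v\<in>A. \<exists>u\<in>C. E u v \<noteq> (u = c)" by auto
    have "\<forall>v\<in>A. \<exists>u\<in>C - {c}. E u v"
    proof
      fix v assume v: "v \<in> A"
      obtain u where u: "u \<in> C" "E u v \<noteq> (u = c)" using c(2) v by blast
      obtain u' where u': "u' \<in> C" "E u' v" using psubset.prems v by blast
      show "\<exists>u\<in>C - {c}. E u v"
      proof (cases "u = c")
        case True
        then show ?thesis using u u' by (intro bexI[of _ u']) auto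
      next
        case False
        then show ?thesis using u by (intro bexI[of _ u]) auto
      qed
    qed
    moreover have "C - {c} \<subset> C" using c(1) by auto
    ultimately obtain C' where "C' \<subseteq> C - {c}" "\<forall>v\<in>A. \<exists>u\<in>C'. E u v"
      "\<forall>c\<in>C'. \<exists>v\<in>A. \<forall>u\<in>C'. E u v \<longleftrightarrow> u = c"
      using psubset.IH[of "C - {c}"] by auto
    then show ?thesis by (intro exI[of _ C']) auto
  qed
qed

lemma levelling_mono:
  assumes "levelling E L m" "k \<le> m" "\<And>i. i \<le> k \<Longrightarrow> M i \<subseteq> L i" "M 0 \<noteq> {}"
    "\<And>i v. i < k \<Longrightarrow> v \<in> M (Suc i) \<Longrightarrow> \<exists>u\<in>M i. E u v"
  shows "levelling E M k"
  unfolding levelling_def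
proof (intro conjI allI impI ballI)
  show "M i \<inter> M j = {}" if ij: "i \<le> k" "j \<le> k" "i \<noteq> j" for i j
  proof -
    have "x \<in> M j \<Longrightarrow> x \<notin> M i" for x
      using levelling_disj[OF assms(1), of i j x] assms(2) assms(3)[OF ij(1)] assms(3)[OF ij(2)] ij by auto
    then show ?thesis by auto
  qed
  show "\<not> E x y" if ij: "i \<le> k" "j \<le> k" "i + 2 \<le> j" and xy: "x \<in> M i" "y \<in> M j" for i j x y
  proof (rule levelling_far[OF assms(1) _ ij(3)])
    show "j \<le> m" using ij assms(2) by simp
  qed (use assms(3)[OF ij(1)] assms(3)[OF ij(2)] xy in auto)
  show "\<exists>u\<in>M i. E u v" if "i < k" "v \<in> M (Suc i)" for i v using assms(5)[OF that] .
  obtain r where "L 0 = {r}" using levelling_root[OF assms(1)] by blast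
  then have "M 0 = {r}" using assms(3)[of 0] assms(4) by auto
  then show "\<exists>r. M 0 = {r}" by blast
qed

lemma levelling_le:
  assumes "levelling E L m" "k \<le> m" shows "levelling E L k"
proof (rule levelling_mono[OF assms order_refl])
  show "L 0 \<noteq> {}" using levelling_root[OF assms(1)] by auto
  show "\<exists>u\<in>L i. E u v" if "i < k" "v \<in> L (Suc i)" for i v
    using levelling_parent[OF assms(1), of i v] that assms(2) by simp
qed

text \<open>Levels are thinned out from the top down, each to a minimal cover of the next. The spine
  grows upwards: its last vertex \<open>S m\<close> lies in the cover \<open>C\<close>, and a
  private child of it in \<open>A\<close> becomes the new end.\<close>

lemma spine_exists:
  assumes "levelling E L m" "A \<subseteq> L m" "A \<noteq> {}" "\<And>i. finite (L i)"
  shows "\<exists>M S. levelling E M m \<and> spine E M S m \<and> M m = A \<and> (\<forall>i\<le>m. M i \<subseteq> L i)"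
  using assms(1-3)
proof (induction m arbitrary: A)
  case 0
  obtain r where r: "L 0 = {r}" using levelling_root[OF 0(1)] by blast
  then have "A = {r}" using 0 by auto
  then show ?case using 0 r by (intro exI[of _ L] exI[of _ "\<lambda>_. r"]) (auto simp: spine_def)
next
  case (Suc m)
  have "\<forall>v\<in>A. \<exists>u\<in>L m. E u v" using levelling_parent[OF Suc.prems(1), of m] Suc.prems(2) by blast
  then obtain C where C: "C \<subseteq> L m" "\<forall>v\<in>A. \<exists>u\<in>C. E u v" "\<forall>c\<in>C. \<exists>v\<in>A. \<forall>u\<in>C. E u v \<longleftrightarrow> u = c"
    using minimal_cover[OF assms(4)[of m], of A E] by blast
  have "C \<noteq> {}" using C(2) Suc.prems(3) by blast
  then obtain M S where M: "levelling E M m" "spine E M S m" "M m = C" "\<forall>i\<le>m. M i \<subseteq> L i"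
    using Suc.IH[OF levelling_le[OF Suc.prems(1)] C(1)] by auto
  have "S m \<in> C" using M(2,3) unfolding spine_def by auto
  then obtain a where a: "a \<in> A" "\<forall>u\<in>C. E u a \<longleftrightarrow> u = S m" using C(3) by blast
  let ?M = "M(Suc m := A)" and ?S = "S(Suc m := a)"
  have le: "?M i \<subseteq> L i" if "i \<le> Suc m" for i using that M(4) Suc.prems(2) by (auto simp: le_Suc_eq)
  have 1: "levelling E ?M (Suc m)"
  proof (rule levelling_mono[OF Suc.prems(1) order_refl le])
    show "?M 0 \<noteq> {}" using levelling_root[OF M(1)] by auto
    show "\<exists>u\<in>?M i. E u v" if "i < Suc m" "v \<in> ?M (Suc i)" for i v
    proof (cases "i = m")
      case True then show ?thesis using that C(2) M(3) by auto
    next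
      case False then show ?thesis using that levelling_parent[OF M(1), of i v] by auto
    qed
  qed
  have 2: "spine E ?M ?S (Suc m)"
    unfolding spine_def
  proof (intro conjI allI impI ballI)
    show "?S i \<in> ?M i" if "i \<le> Suc m" for i using that M(2) a(1) unfolding spine_def by (auto simp: le_Suc_eq)
    show "E u (?S (Suc i)) \<longleftrightarrow> u = ?S i" if "i < Suc m" "u \<in> ?M i" for i u
    proof (cases "i = m")
      case True then show ?thesis using that a(2) M(3) by auto
    next
      case False then show ?thesis using that M(2) unfolding spine_def by auto
    qed
  qed
  have "?M (Suc m) = A" by simp
  then show ?case using 1 2 le by blast
qed

section \<open>Colouring from a stable cover\<close>

definition stable :: "('a \<Rightarrow> 'a \<Rightarrow> bool) \<Rightarrow> 'a set \<Rightarrow> bool" where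
  "stable E A \<longleftrightarrow> (\<forall>x\<in>A. \<forall>y\<in>A. \<not> E x y)"

lemma (in sgraph) clq_insert: "clq E K \<Longrightarrow> (\<And>x. x \<in> K \<Longrightarrow> E v x) \<Longrightarrow> clq E (insert v K)"
  unfolding clq_def using symI by blast

lemma (in sgraph) clb_common_neighbour:
  assumes "clb E (insert v W) w" "v \<notin> W" "finite W" "\<And>x. x \<in> W \<Longrightarrow> E v x"
  shows "clb E W (w - 1)"
  unfolding clb_def
proof (intro allI impI)
  fix K assume K: "K \<subseteq> W" "clq E K"
  then have "clq E (insert v K)" using assms(4) by (intro clq_insert) auto
  moreover have "insert v K \<subseteq> insert v W" using K(1) by auto
  ultimately have "card (insert v K) \<le> w" using assms(1) unfolding clb_def by blast
  moreover have "v \<notin> K" "finite K" using assms(2,3) K(1) finite_subset by auto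
  ultimately show "card K \<le> w - 1" by simp
qed

text \<open>Every vertex is assigned its first neighbour in \<open>A\<close>. In a colour class in which adjacent vertices
  \<open>u\<close>, \<open>v\<close> satisfy \<open>E (f u) v\<close> or \<open>E (f v) u\<close>, the last of the assigned neighbours of a clique is
  adjacent to the whole clique.\<close>

lemma (in sgraph) cross_colouring:
  fixes rk :: "'a \<Rightarrow> nat"
  assumes fin: "finite B" and AB: "A \<inter> B = {}" and rk: "inj_on rk A"
    and f: "\<And>b. b \<in> B \<Longrightarrow> f b \<in> A \<and> E (f b) b" "\<And>b x. b \<in> B \<Longrightarrow> x \<in> A \<Longrightarrow> E x b \<Longrightarrow> rk (f b) \<le> rk x"
    and w: "clb E (A \<union> B) w" and small: "\<And>W. W \<subseteq> B \<Longrightarrow> clb E W (w - 1) \<Longrightarrow> colb E W n"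
    and R: "\<And>u v. u \<in> B \<Longrightarrow> v \<in> B \<Longrightarrow> E u v \<Longrightarrow> \<not> E (f u) v \<Longrightarrow> \<not> E (f v) u \<Longrightarrow> R u v"
    and col: "colb R B c"
  shows "colb E B (c * n)"
proof -
  obtain \<phi> :: "'a \<Rightarrow> nat" where \<phi>: "\<forall>x\<in>B. \<phi> x < c" "\<forall>x\<in>B. \<forall>y\<in>B. R x y \<longrightarrow> \<phi> x \<noteq> \<phi> y"
    using col unfolding colb_def by blast
  show ?thesis
  proof (rule colb_fibres[of _ \<phi>])
    show "\<phi> x < c" if "x \<in> B" for x using \<phi> that by blast
    fix k assume "k < c"
    show "colb E {x \<in> B. \<phi> x = k} n"
    proof (rule small)
      show "clb E {x \<in> B. \<phi> x = k} (w - 1)" unfolding clb_def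
      proof (intro allI impI)
        fix K assume K: "K \<subseteq> {x \<in> B. \<phi> x = k}" "clq E K"
        have KB: "K \<subseteq> B" "finite K" using K(1) fin finite_subset[of K B] by auto
        show "card K \<le> w - 1"
        proof (cases "K = {}")
          case False
          have fr: "finite (rk ` f ` K)" "rk ` f ` K \<noteq> {}" using KB False by auto
          obtain v where v: "v \<in> K" "rk (f v) = Max (rk ` f ` K)" using Max_in[OF fr] by auto
          have max: "rk (f u) \<le> rk (f v)" if "u \<in> K" for u using v(2) Max_ge[OF fr(1)] that by auto
          have vB: "v \<in> B" using v KB by auto
          have adj: "E (f v) u" if u: "u \<in> K" for u
          proof (cases "u = v")
            case True then show ?thesis using f(1)[OF vB] by simp
          next
            case False
            have uB: "u \<in> B" using u KB by auto
            have "E u v" using K(2) u v(1) False unfolding clq_def by blast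
            moreover have "\<phi> u = \<phi> v" using K(1) u v(1) by auto
            then have "\<not> R u v" using \<phi>(2) uB vB by blast
            ultimately have "E (f u) v \<or> E (f v) u" using R[OF uB vB] by blast
            then show ?thesis
            proof
              \<comment> \<open>As \<open>f v\<close> is the first neighbour of \<open>v\<close>, it
                comes no later than \<open>f u\<close>; by the maximality of \<open>v\<close> the
                two coincide.\<close>
              assume "E (f u) v"
              then have "rk (f v) \<le> rk (f u)" using f(2)[OF vB] f(1)[OF uB] by blast
              then have "rk (f u) = rk (f v)" using max[OF u] by simp
              then have "f u = f v" using rk f(1)[OF uB] f(1)[OF vB] by (auto dest: inj_onD)
              then show ?thesis using f(1)[OF uB] by simp
            qed
          qed
          have "clb E (insert (f v) K) w" using clb_mono[OF w _ order_refl] f(1)[OF vB] KB(1) by blast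
          moreover have "f v \<notin> K" using f(1)[OF vB] AB KB(1) by blast
          ultimately have "clb E K (w - 1)" using clb_common_neighbour KB(2) adj by blast
          then show ?thesis using K(2) unfolding clb_def by blast
        qed simp
      qed
    qed auto
  qed
qed

lemma first_neighbour_exists:
  assumes "finite A" "\<And>b. b \<in> B \<Longrightarrow> \<exists>a\<in>A. E a b"
  shows "\<exists>(rk :: 'a \<Rightarrow> nat) f. inj_on rk A \<and> (\<forall>b\<in>B. f b \<in> A \<and> E (f b) b) \<and>
     (\<forall>b\<in>B. \<forall>x\<in>A. E x b \<longrightarrow> rk (f b) \<le> rk x)"
proof -
  obtain rk :: "'a \<Rightarrow> nat" and k where rk: "inj_on rk A"
    using finite_imp_inj_to_nat_seg[OF assms(1)] by blast
  define f where "f b = (ARG_MIN rk x. x \<in> A \<and> E x b)" for b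
  have "f b \<in> A \<and> E (f b) b" if "b \<in> B" for b
    unfolding f_def using arg_min_natI[of "\<lambda>x. x \<in> A \<and> E x b"] assms(2)[OF that] by blast
  moreover have "rk (f b) \<le> rk x" if "x \<in> A" "E x b" for b x
    unfolding f_def using arg_min_nat_le[of "\<lambda>x. x \<in> A \<and> E x b"] that by blast
  ultimately show ?thesis using rk by blast
qed

context sgraph begin

text \<open>Vertices of \<open>A\<close> are joined through the levels below and through
  \<open>U\<close>, so \<open>glue\<close> gives each pair one parity. In the bound, 2 accounts for
  the parity to the end of the spine, \<open>w\<close> for the cograph colouring of the pairs missed
  by assigned neighbours, and \<open>n\<close> for the classes of smaller clique number.\<close>

lemma stable_cover_colouring:
  assumes ohf: "odd_hole_free E" and lev: "levelling E L m" "\<And>i. finite (L i)"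
    and A: "A \<subseteq> L m" "stable E A"
    and U: "conn E U" "finite U" "U \<inter> below L m = {}" "A \<inter> U = {}"
      "\<And>x y. x \<in> below L m \<Longrightarrow> y \<in> U \<Longrightarrow> \<not> E x y" "\<And>a. a \<in> A \<Longrightarrow> \<exists>u\<in>U. E a u"
    and B: "B \<subseteq> U" "\<And>b. b \<in> B \<Longrightarrow> \<exists>a\<in>A. E a b"
    and w: "clb E (A \<union> B) w" and small: "\<And>W. W \<subseteq> B \<Longrightarrow> clb E W (w - 1) \<Longrightarrow> colb E W n"
  shows "colb E B (2 * (w * n))"
proof (cases "A = {}")
  case True
  then have "B = {}" using B(2) by blast
  then show ?thesis by (simp add: colb_def)
next
  case False
  obtain M S where M: "levelling E M m" "spine E M S m" "M m = A" "\<forall>i\<le>m. M i \<subseteq> L i"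
    using spine_exists[OF lev(1) A(1) False lev(2)] by blast
  interpret spined E M m S by unfold_locales (use M in auto)
  let ?r = "S m"
  have rA: "?r \<in> A" using S_in[of m] M(3) by simp
  have finB: "finite B" using U(2) B(1) finite_subset by blast
  have finA: "finite A" using A(1) lev(2) finite_subset by blast
  have nA: "\<not> E x y" if "x \<in> A" "y \<in> A" for x y using A(2) that unfolding stable_def by blast
  \<comment> \<open>Defined by paths through \<open>U\<close>; with \<open>gl\<close>, every path
    through \<open>U\<close> or through the levels below gives the same answer.\<close>
  define J where "J x y \<longleftrightarrow> (\<exists>k. odd k \<and> lnk E U x y k)" for x y
  have J_sym: "J x y \<longleftrightarrow> J y x" for x y unfolding J_def using lnk_sym[of U x y] lnk_sym[of U y x] by blast
  have J_irr: "\<not> J x x" for x unfolding J_def using lnk_neq by blast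
  have belowML: "below M m \<subseteq> below L m" using M(4) by (intro UN_mono) auto
  have low: "\<exists>k. lnk E (below M m) x y k" if "x \<in> A" "y \<in> A" "x \<noteq> y" for x y
    using base_path[of m x y] M(3) that by simp
  have up: "\<exists>k. lnk E U x y k" if xy: "x \<in> A" "y \<in> A" "x \<noteq> y" for x y
  proof -
    obtain u where u: "u \<in> U" "E x u" using U(6)[OF xy(1)] by blast
    obtain v where v: "v \<in> U" "E y v" using U(6)[OF xy(2)] by blast
    show ?thesis using lnk_exists[OF U(1) u v(1) sym[OF v(2)] xy(3)] .
  qed
  have gl: "odd k \<longleftrightarrow> odd l" if "lnk E (below M m) x y k" "lnk E U x y l" "x \<in> A" "y \<in> A" for x y k l
  proof (rule glue[OF ohf that(1,2) nA[OF that(3,4)]])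
    have "z \<notin> U" if "z \<in> below M m" for z using subsetD[OF belowML that] U(3) by blast
    then show "below M m \<inter> U = {}" by blast
    show "\<not> E x y" if "x \<in> below M m" "y \<in> U" for x y using U(5)[OF subsetD[OF belowML that(1)] that(2)] .
  qed
  have J_iff: "J x y \<longleftrightarrow> odd l" if xy: "lnk E U x y l" "x \<in> A" "y \<in> A" for x y l
  proof -
    obtain k where k: "lnk E (below M m) x y k" using low[OF xy(2,3) lnk_neq[OF xy(1)]] by blast
    have "odd l' \<longleftrightarrow> odd l" if "lnk E U x y l'" for l'
      using gl[OF k that \<open>x \<in> A\<close> \<open>y \<in> A\<close>] gl[OF k \<open>lnk E U x y l\<close> \<open>x \<in> A\<close> \<open>y \<in> A\<close>] by blast
    then show ?thesis unfolding J_def using xy(1) by blast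
  qed
  have J_par: "par E (below M m) x y (J x y)" if xy: "x \<in> A" "y \<in> A" "x \<noteq> y" for x y
    unfolding par_def
  proof (intro allI impI)
    fix k assume k: "lnk E (below M m) x y k"
    obtain l where l: "lnk E U x y l" using up[OF xy] by blast
    show "odd k \<longleftrightarrow> J x y" using gl[OF k l xy(1,2)] J_iff[OF l xy(1,2)] by blast
  qed
  have p4: "p4free J {x\<in>A. J ?r x \<longleftrightarrow> \<epsilon>}" for \<epsilon>
    unfolding p4free_def
  proof (intro ballI impI, rule ccontr)
    fix a b c d
    let ?C = "{x\<in>A. J ?r x \<longleftrightarrow> \<epsilon>}"
    assume C: "a \<in> ?C" "b \<in> ?C" "c \<in> ?C" "d \<in> ?C" and J: "J a b" "J b c" "J c d"
      and n: "\<not> (J a c \<or> J b d \<or> J a d)"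
    have "a \<noteq> c" "b \<noteq> d" "a \<noteq> d" using J n J_sym[of b c] J_sym[of d c] by auto
    then have dist: "distinct [a,b,c,d]" using J J_irr by auto
    \<comment> \<open>If \<open>?r = x\<close>, then \<open>\<epsilon>\<close> is false because
      \<open>J ?r ?r\<close> fails, but true because \<open>J ?r y\<close> holds.\<close>
    have r: "?r \<noteq> x" if "x \<in> ?C" "y \<in> ?C" "J x y" for x y using that J_irr by auto
    have rn: "?r \<notin> {a,b,c,d}" using r[OF C(1,2) J(1)] r[OF C(2,3) J(2)] r[OF C(3,4) J(3)]
        r[OF C(4,3)] J(3) J_sym[of c d] by auto
    show False
    proof (rule top_P4[of a b c d])
      show "{a,b,c,d} \<subseteq> M m" using C M(3) by auto
      show "\<not> E x y" if "{x,y} \<subseteq> {a,b,c,d,?r}" for x y using nA that C rA by auto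
      show "par E (below M m) ?r x \<epsilon>" if "x \<in> {a,b,c,d}" for x
      proof -
        have "x \<in> ?C" using that C by blast
        then show ?thesis using J_par[OF rA, of x] rn that by auto
      qed
    qed (use rn dist J_par[of a b] J_par[of b c] J_par[of c d] J_par[of a c] J_par[of b d] J_par[of a d] J n C in auto)
  qed
  obtain rk :: "'a \<Rightarrow> nat" and f where rk: "inj_on rk A"
    and f: "\<forall>b\<in>B. f b \<in> A \<and> E (f b) b" "\<forall>b\<in>B. \<forall>x\<in>A. E x b \<longrightarrow> rk (f b) \<le> rk x"
    using first_neighbour_exists[OF finA, of B E] B(2) by blast
  have BA: "b \<notin> A" if "b \<in> B" for b using that B(1) U(4) by blast
  have part: "colb E {b\<in>B. J ?r (f b) \<longleftrightarrow> \<epsilon>} (w * n)" for \<epsilon>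
  proof (rule cross_colouring[where A = A and rk = rk and f = f and w = w])
    let ?B = "{b\<in>B. J ?r (f b) \<longleftrightarrow> \<epsilon>}"
    \<comment> \<open>The adjacent pairs not covered by either assigned neighbour;
      \<open>cross_colouring\<close> needs them separated.\<close>
    define R where "R u v \<longleftrightarrow> E u v \<and> u \<in> B \<and> v \<in> B \<and> \<not> E (f u) v \<and> \<not> E (f v) u" for u v
    show "R u v" if "u \<in> ?B" "v \<in> ?B" "E u v" "\<not> E (f u) v" "\<not> E (f v) u" for u v
      using that unfolding R_def by auto
    have fne: "f u \<noteq> f v" if "R u v" for u v using that f(1) unfolding R_def by metis
    have fB: "f u \<noteq> v" "v \<noteq> f u" if "u \<in> B" "v \<in> B" for u v using f(1) that BA by blast+
    have RJ: "J (f u) (f v)" if R: "R u v" for u v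
    proof -
      have uv: "E u v" "u \<in> B" "v \<in> B" "\<not> E (f u) v" "\<not> E u (f v)" using R symI[of u "f v"] unfolding R_def by auto
      have fA: "f u \<in> A" "f v \<in> A" "E (f u) u" "E v (f v)" using f(1) uv(2,3) symI[of v "f v"] by auto
      have "lnk E {u,v} (f u) (f v) 3"
        using lnk3[OF fA(3) uv(1) fA(4) uv(4) nA[OF fA(1,2)] uv(5)] fne[OF R] fB uv by auto
      then have "lnk E U (f u) (f v) 3" by (rule lnk_mono) (use uv B(1) in auto)
      then show ?thesis using J_iff fA by auto
    qed
    \<comment> \<open>The transfer condition of \<open>cograph_colouring\<close>. If
      \<open>b\<close> and \<open>d\<close> were nonadjacent, \<open>f b, b, c, d, f d\<close> would
      be an induced path of length 4 for an odd pair; a common neighbour of \<open>f b\<close> and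
      \<open>f d\<close> in \<open>B\<close> would give one of length 2.\<close>
    have RR: "R b d" if R: "R b c" "R c d" "J (f b) (f d)" for b c d
    proof -
      have mem: "b \<in> B" "c \<in> B" "d \<in> B" "E b c" "E c d" using R unfolding R_def by auto
      have nn: "\<not> E (f b) c" "\<not> E c (f d)" using R(1,2) symI[of c "f d"] unfolding R_def by auto
      have fA: "f b \<in> A" "f d \<in> A" "E (f b) b" "E d (f d)" using f(1) mem(1,3) symI[of d "f d"] by auto
      have ne: "f b \<noteq> f d" using R(3) J_irr by metis
      have nshare: False if "E (f b) z" "E z (f d)" "z \<in> B" for z
      proof -
        have "lnk E {z} (f b) (f d) 2" using lnk2[OF that(1,2) nA[OF fA(1,2)] ne] .
        then have "lnk E U (f b) (f d) 2" by (rule lnk_mono) (use that B(1) in auto)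
        then show False using J_iff fA R(3) by fastforce
      qed
      have n: "\<not> E (f b) d" "\<not> E b (f d)"
        using nshare[of d] nshare[of b] fA(3,4) mem(1,3) by auto
      have "E b d"
      proof (rule ccontr)
        assume bd: "\<not> E b d"
        have "b \<noteq> d" using n(1) fA(3) by auto
        moreover have "b \<noteq> c" "c \<noteq> d" using mem irrefl by auto
        ultimately have "distinct [f b, b, c, d, f d]" using ne fB mem by auto
        then have "lnk E {b,c,d} (f b) (f d) 4"
          using lnk4[OF fA(3) mem(4,5) fA(4) nn(1) n(1) nA[OF fA(1,2)] bd n(2) nn(2)] by blast
        then have "lnk E U (f b) (f d) 4" by (rule lnk_mono) (use mem B(1) in auto)
        then show False using J_iff fA R(3) by fastforce
      qed
      then show ?thesis unfolding R_def using mem n symI[of b "f d"] by auto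
    qed
    show "colb R ?B w"
    proof (rule cograph_colouring[where J = "\<lambda>u v. J (f u) (f v)"])
      show "sgraph R"
      proof
        show "R v u" if "R u v" for u v using that sym[of u v] unfolding R_def by blast
        show "\<not> R u u" for u using irrefl unfolding R_def by blast
      qed
      show "sgraph (\<lambda>u v. J (f u) (f v))"
      proof
        show "J (f v) (f u)" if "J (f u) (f v)" for u v using that J_sym[of "f u"] by blast
      qed (rule J_irr)
      show "p4free (\<lambda>u v. J (f u) (f v)) ?B"
        unfolding p4free_def
      proof (intro ballI impI)
        fix a b c d assume "a \<in> ?B" "b \<in> ?B" "c \<in> ?B" "d \<in> ?B" "J (f a) (f b)" "J (f b) (f c)" "J (f c) (f d)"
        then show "J (f a) (f c) \<or> J (f b) (f d) \<or> J (f a) (f d)"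
          using p4freeD[OF p4[of \<epsilon>], of "f a" "f b" "f c" "f d"] f(1) by auto
      qed
      show "clb R ?B w" unfolding clb_def
      proof (intro allI impI)
        fix K assume K: "K \<subseteq> ?B" "clq R K"
        have "clq E K" using K(2) unfolding clq_def R_def by blast
        moreover have "K \<subseteq> A \<union> B" using K(1) by auto
        ultimately show "card K \<le> w" using w unfolding clb_def by blast
      qed
      show "R b d" if "R b c" "R c d" "J (f b) (f d)" for b c d using RR[OF that] .
      show "J (f u) (f v)" if "R u v" for u v using RJ[OF that] .
      show "finite ?B" using finB by simp
    qed
    show "clb E (A \<union> ?B) w" by (rule clb_mono[OF w]) auto
    show "colb E W n" if "W \<subseteq> ?B" "clb E W (w - 1)" for W
      by (rule small[OF _ that(2)]) (use that(1) in auto)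
  qed (use finB rk f BA in auto)
  show ?thesis
  proof (rule colb_fibres[of _ "\<lambda>b. if J ?r (f b) then 1 else 0"])
    fix c :: nat assume "c < 2"
    show "colb E {b\<in>B. (if J ?r (f b) then 1 else 0) = c} (w * n)"
      by (rule colb_mono[OF part[of "c = 1"]]) (use \<open>c < 2\<close> in auto)
  qed auto
qed

end

section \<open>Breadth-first levels\<close>

text \<open>Local properties that characterise the distance from \<open>r\<close> within
  \<open>C\<close>; the values of \<open>d\<close> outside \<open>C\<close> are arbitrary.\<close>

definition bfs :: "('a \<Rightarrow> 'a \<Rightarrow> bool) \<Rightarrow> 'a set \<Rightarrow> 'a \<Rightarrow> ('a \<Rightarrow> nat) \<Rightarrow> bool" where
  "bfs E C r d \<longleftrightarrow> r \<in> C \<and> (\<forall>x\<in>C. d x = 0 \<longleftrightarrow> x = r) \<and> (\<forall>x\<in>C. \<forall>y\<in>C. E x y \<longrightarrow> d y \<le> Suc (d x)) \<and>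
     (\<forall>x\<in>C. \<forall>i. d x = Suc i \<longrightarrow> (\<exists>y\<in>C. d y = i \<and> E y x))"

lemma bfs_exists:
  assumes "conn E C" "r \<in> C"
  shows "\<exists>d. bfs E C r d"
proof -
  define R where "R = (\<lambda>x y. E x y \<and> x \<in> C \<and> y \<in> C)"
  define d where "d x = (LEAST n. (R ^^ n) r x)" for x
  have ex: "\<exists>n. (R ^^ n) r x" if "x \<in> C" for x
  proof -
    have "linked E C r x" using assms that unfolding conn_def by blast
    then have "R\<^sup>*\<^sup>* r x" unfolding linked_def R_def .
    then show ?thesis unfolding rtranclp_power .
  qed
  have dR: "(R ^^ d x) r x" if "x \<in> C" for x unfolding d_def using ex[OF that] by (rule LeastI_ex)
  have dle: "d x \<le> n" if "(R ^^ n) r x" for x n unfolding d_def using that by (rule Least_le)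
  have 0: "d x = 0 \<longleftrightarrow> x = r" if "x \<in> C" for x
  proof
    assume "d x = 0" then show "x = r" using dR[OF that] by simp
  next
    assume "x = r" then show "d x = 0" using dle[of 0 x] by simp
  qed
  have 1: "d y \<le> Suc (d x)" if "x \<in> C" "y \<in> C" "E x y" for x y
  proof -
    have "(R ^^ Suc (d x)) r y" using dR[OF that(1)] that by (auto simp: R_def)
    then show ?thesis by (rule dle)
  qed
  have 2: "\<exists>y\<in>C. d y = i \<and> E y x" if "x \<in> C" "d x = Suc i" for x i
  proof -
    have "(R ^^ Suc i) r x" using dR[OF that(1)] that(2) by simp
    then obtain y where y: "(R ^^ i) r y" "R y x" by auto
    then have yC: "y \<in> C" "E y x" by (auto simp: R_def)
    have "d y \<le> i" using y(1) by (rule dle)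
    moreover have "Suc i \<le> Suc (d y)" using 1[OF yC(1) that(1) yC(2)] that(2) by simp
    ultimately show ?thesis using yC by auto
  qed
  have "bfs E C r d" unfolding bfs_def
    by (intro conjI ballI impI allI) (fact assms(2), erule 0, erule (2) 1, erule (1) 2)
  then show ?thesis by blast
qed

lemma bfs_root: "bfs E C r d \<Longrightarrow> r \<in> C"
  unfolding bfs_def by (elim conjE)

lemma bfs_zero: "bfs E C r d \<Longrightarrow> x \<in> C \<Longrightarrow> d x = 0 \<longleftrightarrow> x = r"
  unfolding bfs_def by (elim conjE) (drule (1) bspec)

lemma bfs_step:
  assumes "bfs E C r d" "x \<in> C" "y \<in> C" "E x y" shows "d y \<le> Suc (d x)"
proof -
  have "\<forall>x\<in>C. \<forall>y\<in>C. E x y \<longrightarrow> d y \<le> Suc (d x)" using assms(1) unfolding bfs_def by (elim conjE)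
  then show ?thesis using assms(2-) by blast
qed

lemma bfs_parent:
  assumes "bfs E C r d" "x \<in> C" "d x = Suc i" shows "\<exists>y\<in>C. d y = i \<and> E y x"
proof -
  have "\<forall>x\<in>C. \<forall>i. d x = Suc i \<longrightarrow> (\<exists>y\<in>C. d y = i \<and> E y x)" using assms(1) unfolding bfs_def by (elim conjE)
  then show ?thesis using assms(2-) by blast
qed

context sgraph begin

lemma conn_component: "conn E {y\<in>W. linked E W x y}"
proof -
  define C where "C = {y\<in>W. linked E W x y}"
  have memC: "y \<in> C \<longleftrightarrow> y \<in> W \<and> linked E W x y" for y unfolding C_def by simp
  have l: "linked E C x y" if "linked E W x y" for y
    using that unfolding linked_def[of E W]
  proof (induction rule: rtranclp_induct)
    case base then show ?case by (rule linked_refl)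
  next
    case (step y z)
    have y: "linked E W x y" using step.hyps(1) unfolding linked_def .
    have z: "linked E W x z" using linked_step[OF y] step.hyps(2) by simp
    show ?case using linked_step[OF step.IH, of z] step.hyps(2) y z memC by simp
  qed
  have "conn E C" by (rule connI[of _ x]) (rule linked_sym[OF l], simp add: memC)
  then show ?thesis unfolding C_def .
qed

lemma colb_conn:
  assumes "\<And>C. C \<subseteq> W \<Longrightarrow> conn E C \<Longrightarrow> colb E C k"
  shows "colb E W k"
proof (rule colb_comps[of _ _ "\<lambda>x. {y\<in>W. linked E W x y}"])
  fix x y assume xy: "x \<in> W" "y \<in> W" "E x y"
  have 1: "linked E W x y" by (rule linked_step[OF linked_refl xy(3,1,2)])
  have "linked E W x z \<longleftrightarrow> linked E W y z" for z
    using linked_trans[OF 1] linked_trans[OF linked_sym[OF 1]] by blast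
  then show "{z\<in>W. linked E W x z} = {z\<in>W. linked E W y z}" by simp
next
  fix x assume x: "x \<in> W"
  have "{y\<in>W. {z\<in>W. linked E W y z} = {z\<in>W. linked E W x z}} \<subseteq> {z\<in>W. linked E W x z}"
  proof
    fix y assume "y \<in> {y\<in>W. {z\<in>W. linked E W y z} = {z\<in>W. linked E W x z}}"
    then have y: "y \<in> W" "{z\<in>W. linked E W y z} = {z\<in>W. linked E W x z}" by simp_all
    have "y \<in> {z\<in>W. linked E W y z}" using y(1) linked_refl by simp
    then show "y \<in> {z\<in>W. linked E W x z}" using y(2) by simp
  qed
  moreover have "colb E {z\<in>W. linked E W x z} k" by (rule assms[OF _ conn_component]) auto
  ultimately show "colb E {y\<in>W. {z\<in>W. linked E W y z} = {z\<in>W. linked E W x z}} k"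
    using colb_mono[OF _ _ order_refl] by blast
qed

text \<open>Components share colours, their even and odd levels use different palettes, and the
  components of a level share colours again.\<close>

lemma colb_bfs:
  assumes "\<And>C r d i D. C \<subseteq> W \<Longrightarrow> bfs E C r d \<Longrightarrow> D \<subseteq> {x\<in>C. d x = i} \<Longrightarrow> conn E D \<Longrightarrow> colb E D k"
  shows "colb E W (2 * k)"
proof (rule colb_conn)
  fix C assume C: "C \<subseteq> W" "conn E C"
  show "colb E C (2 * k)"
  proof (cases "C = {}")
    case True then show ?thesis by (simp add: colb_def)
  next
    case False
    then obtain r where r: "r \<in> C" by blast
    obtain d where d: "bfs E C r d" using bfs_exists[OF C(2) r] by blast
    show ?thesis
    proof (rule colb_levels[of _ _ d])
      show "d x \<le> Suc (d y) \<and> d y \<le> Suc (d x)" if "x \<in> C" "y \<in> C" "E x y" for x y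
        using bfs_step[OF d that] bfs_step[OF d that(2,1) sym[OF that(3)]] by simp
      show "colb E {x\<in>C. d x = i} k" for i
        by (rule colb_conn) (rule assms[OF C(1) d])
    qed
  qed
qed

lemma bfs_nonadj:
  assumes "bfs E C r d" "x \<in> C" "y \<in> C" "d x + 2 \<le> d y"
  shows "\<not> E x y" "\<not> E y x"
  using bfs_step[OF assms(1-3)] symI[of y x] assms(4) by auto

text \<open>A shortest path is induced, since levels at least two apart are anticomplete.\<close>

lemma bfs_geodesic:
  assumes "bfs E C r d"
  shows "x \<in> C \<Longrightarrow> d x = Suc i \<Longrightarrow> lnk E {y\<in>C. 0 < d y \<and> d y < Suc i} r x (Suc i)"
proof (induction i arbitrary: x)
  case 0
  obtain y where "y \<in> C" "d y = 0" "E y x" using bfs_parent[OF assms 0] by blast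
  then have "E r x" using bfs_zero[OF assms] by blast
  then show ?case using lnk_edge by fastforce
next
  case (Suc i)
  obtain p where p: "p \<in> C" "d p = Suc i" "E p x" using bfs_parent[OF assms Suc.prems] by blast
  have r: "r \<in> C" "d r = 0" using bfs_root[OF assms] bfs_zero[OF assms, of r] by auto
  have "lnk E (insert p {y\<in>C. 0 < d y \<and> d y < Suc i}) r x (Suc (Suc i))"
  proof (rule lnk_snoc[OF Suc.IH[OF p(1,2)] p(3)])
    show "\<not> E r x" using bfs_nonadj[OF assms r(1) Suc.prems(1)] r(2) Suc.prems(2) by simp
    show "r \<noteq> x" using r Suc.prems by auto
    show "\<not> E y x" if "y \<in> {y\<in>C. 0 < d y \<and> d y < Suc i}" for y
      using bfs_nonadj[OF assms _ Suc.prems(1), of y] that Suc.prems(2) by simp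
    show "x \<notin> {y\<in>C. 0 < d y \<and> d y < Suc i}" using Suc.prems by simp
  qed
  then show ?case by (rule lnk_mono) (use p in auto)
qed

text \<open>In a breadth-first levelling of a parity graph, adjacent vertices of a level have the same parents,
  so that every component of a level lies in the neighbourhood of a vertex and is a cograph.\<close>

lemma parity_graph_colouring:
  assumes fin: "finite A" and par: "\<And>x y. x \<in> A \<Longrightarrow> y \<in> A \<Longrightarrow> x \<noteq> y \<Longrightarrow> \<not> E x y \<Longrightarrow> \<exists>\<epsilon>. par E A x y \<epsilon>"
    and w: "clb E A w" "2 \<le> w"
  shows "colb E A (2 * (w - 1))"
proof (rule colb_bfs)
  fix C r d i D
  assume C: "C \<subseteq> A" and d: "bfs E C r d" and D: "D \<subseteq> {x\<in>C. d x = i}" and cD: "conn E D"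
  have same: "odd k \<longleftrightarrow> odd l" if xy: "lnk E S x y k" "lnk E T x y l" "S \<subseteq> A" "T \<subseteq> A" "x \<in> A" "y \<in> A" "\<not> E x y"
    for S T x y k l
  proof -
    obtain \<epsilon> where e: "par E A x y \<epsilon>" using par[OF xy(5,6) lnk_neq[OF xy(1)] xy(7)] by blast
    show ?thesis using parD[OF e xy(1,3)] parD[OF e xy(2,4)] by simp
  qed
  have rC: "r \<in> C" "d r = 0" using bfs_root[OF d] bfs_zero[OF d, of r] by auto
  show "colb E D (w - 1)"
  proof (cases i)
    case 0
    then have "D \<subseteq> {r}" using D bfs_zero[OF d] by auto
    then show ?thesis using w(2) irrefl by (intro colb_stable) auto
  next
    case (Suc j)
    show ?thesis
    proof (cases "D = {}")
      case True then show ?thesis by (simp add: colb_def)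
    next
      case False
      then obtain x0 where x0: "x0 \<in> D" by blast
      obtain p where p: "p \<in> C" "d p = j" "E p x0" using bfs_parent[OF d, of x0 j] x0 D Suc by blast
      \<comment> \<open>If \<open>p\<close> missed \<open>v\<close>, a shortest path to
        \<open>p\<close> continued by \<open>u\<close> and \<open>v\<close> would be induced and one
        longer than a shortest path to \<open>v\<close>, against the common parity.\<close>
      have stepp: "E p v" if uv: "u \<in> D" "v \<in> D" "E u v" "E p u" for u v
      proof (cases j)
        case 0
        then have "p = r" using p bfs_zero[OF d] by simp
        obtain y where y: "y \<in> C" "d y = 0" "E y v" using bfs_parent[OF d, of v 0] uv D Suc 0 by auto
        then have "y = r" using bfs_zero[OF d] by simp
        then show ?thesis using y \<open>p = r\<close> by simp
      next
        case (Suc j')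
        show ?thesis
        proof (rule ccontr)
          assume npv: "\<not> E p v"
          have uC: "u \<in> C" "v \<in> C" "d u = Suc j" "d v = Suc j" using uv D \<open>i = Suc j\<close> by auto
          let ?T = "{y\<in>C. 0 < d y \<and> d y < j}"
          have 1: "lnk E ?T r p j" using bfs_geodesic[OF d p(1), of j'] p(2) Suc by simp
          have rn: "\<not> E r u" "\<not> E r v" "r \<noteq> u" "r \<noteq> v"
            using bfs_nonadj[OF d rC(1) uC(1)] bfs_nonadj[OF d rC(1) uC(2)] rC uC Suc by auto
          have Tn: "\<not> E y u" "\<not> E y v" if "y \<in> ?T" for y
            using bfs_nonadj[OF d _ uC(1), of y] bfs_nonadj[OF d _ uC(2), of y] that uC by auto
          have 2: "lnk E (insert p ?T) r u (Suc j)"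
            by (rule lnk_snoc[OF 1 uv(4) rn(1,3)]) (use Tn uC in auto)
          have 3: "lnk E (insert u (insert p ?T)) r v (Suc (Suc j))"
            by (rule lnk_snoc[OF 2 uv(3) rn(2,4)]) (use Tn npv uC p(2) in auto)
          have 4: "lnk E {y\<in>C. 0 < d y \<and> d y < Suc j} r v (Suc j)" using bfs_geodesic[OF d uC(2,4)] .
          have "odd (Suc (Suc j)) \<longleftrightarrow> odd (Suc j)"
            by (rule same[OF 3 4]) (use C uC p rC rn in auto)
          then show False by simp
        qed
      qed
      have all: "E p x" if "x \<in> D" for x
      proof -
        have "linked E D x0 x" using cD x0 that unfolding conn_def by blast
        then show ?thesis unfolding linked_def
          by (induction rule: rtranclp_induct) (use p(3) stepp in auto)
      qed
      have pD: "p \<notin> D" using p(2) D Suc by auto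
      have DA: "D \<subseteq> A" using D C by auto
      have finD: "finite D" using DA fin finite_subset by blast
      have clbD: "clb E D (w - 1)"
      proof (rule clb_common_neighbour[OF _ pD finD all])
        show "clb E (insert p D) w" by (rule clb_mono[OF w(1)]) (use DA p(1) C in auto)
      qed
      \<comment> \<open>An induced path \<open>a, b, c, e\<close> has length 3, while
        \<open>a, p, e\<close> has length 2.\<close>
      have p4: "p4free E D"
        unfolding p4free_def
      proof (intro ballI impI, rule ccontr)
        fix a b c e assume D4: "a \<in> D" "b \<in> D" "c \<in> D" "e \<in> D" and e: "E a b" "E b c" "E c e"
          and n: "\<not> (E a c \<or> E b e \<or> E a e)"
        have ne: "a \<noteq> c" "a \<noteq> e" "b \<noteq> e" using e n symI[of c a] symI[of c e] symI[of b c] by auto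
        have 1: "lnk E {b,c} a e 3" using lnk3[OF e] n ne by blast
        have 2: "lnk E {p} a e 2" using lnk2[OF sym[OF all[OF D4(1)]] all[OF D4(4)]] n ne by blast
        have "odd (3::nat) \<longleftrightarrow> odd (2::nat)"
          by (rule same[OF 1 2]) (use D4 DA p(1) C n in auto)
        then show False by simp
      qed
      \<comment> \<open>With \<open>R\<close> and \<open>J\<close> both equal to \<open>E\<close>,
        \<open>cograph_colouring\<close> is the perfection of cographs.\<close>
      show ?thesis
        by (rule cograph_colouring[where J = E]) (use finD p4 clbD sgraph_axioms in auto)
    qed
  qed
qed

end

lemma bfs_levelling:
  assumes "sgraph E" "bfs E C r d"
  shows "levelling E (\<lambda>i. {x\<in>C. d x = i}) m"
proof -
  interpret sgraph E by fact
  show ?thesis unfolding levelling_def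
  proof (intro conjI allI impI ballI)
    show "\<not> E x y" if "i + 2 \<le> j" "x \<in> {x\<in>C. d x = i}" "y \<in> {x\<in>C. d x = j}" for i j x y
      using bfs_nonadj[OF assms(2), of x y] that by auto
    show "\<exists>u\<in>{x\<in>C. d x = i}. E u v" if "v \<in> {x\<in>C. d x = Suc i}" for i v
      using bfs_parent[OF assms(2), of v i] that by auto
    have "{x\<in>C. d x = 0} = {r}" using bfs_zero[OF assms(2)] bfs_root[OF assms(2)] by auto
    then show "\<exists>r. {x\<in>C. d x = 0} = {r}" by blast
  qed auto
qed

context sgraph begin

lemma clb_subset_small: "clb E W w \<Longrightarrow> U \<subseteq> W \<Longrightarrow> clb E U w"
  by (rule clb_mono) auto

text \<open>The level \<open>A2\<close> is a parity graph, since each of its vertices has a private child and the children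
  are connected through \<open>D\<close>. Its colour classes cover \<open>A1\<close>, whose colour classes cover \<open>D\<close>.\<close>

lemma level_colouring:
  assumes ohf: "odd_hole_free E" and fin: "finite C" and d: "bfs E C r d"
    and D: "D \<subseteq> {x\<in>C. d x = Suc (Suc m)}" "conn E D"
    and w: "clb E C w" "2 \<le> w" and small: "\<And>W. W \<subseteq> C \<Longrightarrow> clb E W (w - 1) \<Longrightarrow> colb E W n"
  shows "colb E D (2 * (w - 1) * (2 * (w * n)) * (2 * (w * n)))"
proof (cases "D = {}")
  case True then show ?thesis by (simp add: colb_def)
next
  case False
  let ?L = "\<lambda>i. {x\<in>C. d x = i}"
  have lev: "levelling E ?L k" for k by (rule bfs_levelling[OF sgraph_axioms d])
  have finL: "finite (?L k)" for k using fin by simp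
  have "\<forall>v\<in>D. \<exists>u\<in>?L (Suc m). E u v" using bfs_parent[OF d, of _ "Suc m"] D(1) by blast
  from minimal_cover[OF finL this] obtain A1 where A1: "A1 \<subseteq> ?L (Suc m)" "\<forall>v\<in>D. \<exists>u\<in>A1. E u v"
    "\<forall>c\<in>A1. \<exists>v\<in>D. \<forall>u\<in>A1. E u v \<longleftrightarrow> u = c" by blast
  have "\<forall>v\<in>A1. \<exists>u\<in>?L m. E u v" using bfs_parent[OF d, of _ m] A1(1) by blast
  from minimal_cover[OF finL this] obtain A2 where A2: "A2 \<subseteq> ?L m" "\<forall>v\<in>A1. \<exists>u\<in>A2. E u v"
    "\<forall>c\<in>A2. \<exists>v\<in>A1. \<forall>u\<in>A2. E u v \<longleftrightarrow> u = c" by blast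
  have finD: "finite D" "finite A1" "finite A2"
    using D(1) A1(1) A2(1) finL finite_subset by blast+
  have sub: "D \<subseteq> C" "A1 \<subseteq> C" "A2 \<subseteq> C" using D(1) A1(1) A2(1) by auto
  have dD: "d x = Suc (Suc m)" if "x \<in> D" for x using D(1) that by auto
  have dA1: "d x = Suc m" if "x \<in> A1" for x using A1(1) that by auto
  have dA2: "d x = m" if "x \<in> A2" for x using A2(1) that by auto
  have childA1: "\<exists>v\<in>D. E x v" if "x \<in> A1" for x using A1(3) that by blast
  have conn_up: "conn E (T \<union> D)" if T: "T \<subseteq> A1" for T
  proof -
    obtain d0 where d0: "d0 \<in> D" using False by blast
    show ?thesis
    proof (rule connI[of _ d0])
      have lD: "linked E (T \<union> D) x d0" if "x \<in> D" for x
      proof -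
        have "linked E D x d0" using D(2) d0 that unfolding conn_def by blast
        then show ?thesis by (rule linked_mono) auto
      qed
      fix x assume x: "x \<in> T \<union> D"
      show "linked E (T \<union> D) x d0"
      proof (cases "x \<in> D")
        case True then show ?thesis by (rule lD)
      next
        case False
        then obtain v where v: "v \<in> D" "E x v" using childA1[of x] x T by auto
        have "linked E (T \<union> D) x v" by (rule linked_step[OF linked_refl v(2)]) (use x v in auto)
        then show ?thesis using linked_trans lD[OF v(1)] by blast
      qed
    qed
  qed
  have A2D: "\<not> E x y" if "x \<in> A2" "y \<in> D" for x y
    using bfs_nonadj[OF d, of x y] that sub dA2[OF that(1)] dD[OF that(2)] by auto
  have col2: "colb E A2 (2 * (w - 1))"
  proof (rule parity_graph_colouring[OF finD(3) _ _ w(2)])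
    show "clb E A2 w" by (rule clb_subset_small[OF w(1) sub(3)])
    fix x y assume xy: "x \<in> A2" "y \<in> A2" "x \<noteq> y" "\<not> E x y"
    obtain u where u: "u \<in> A1" "\<forall>z\<in>A2. E z u \<longleftrightarrow> z = x" using A2(3) xy(1) by blast
    obtain v where v: "v \<in> A1" "\<forall>z\<in>A2. E z v \<longleftrightarrow> z = y" using A2(3) xy(2) by blast
    \<comment> \<open>The private children make this set anticomplete to the rest of
      \<open>A2\<close>, as \<open>glue\<close> requires.\<close>
    let ?T = "{u,v} \<union> D"
    have xu: "E x u" using u(2) xy(1) by simp
    have yv: "E y v" using v(2) xy(2) by simp
    have cT: "conn E ?T" using conn_up[of "{u,v}"] u(1) v(1) by simp
    have "u \<in> ?T" "v \<in> ?T" by simp_all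
    then obtain l where l: "lnk E ?T x y l"
      using lnk_exists[OF cT _ xu _ sym[OF yv] xy(3)] by blast
    have "par E A2 x y (odd l)" unfolding par_def
    proof (intro allI impI)
      fix k assume "lnk E A2 x y k"
      then have k: "lnk E (A2 - {x,y}) x y k" by (rule lnk_diff)
      show "odd k \<longleftrightarrow> odd l"
      proof (rule glue[OF ohf k l xy(4)])
        show "\<not> E a b" if "a \<in> A2 - {x,y}" "b \<in> ?T" for a b
        proof -
          have "a \<in> A2" "a \<noteq> x" "a \<noteq> y" using that(1) by auto
          moreover have "b = u \<or> b = v \<or> b \<in> D" using that(2) by simp
          ultimately show ?thesis using u(2) v(2) A2D[of a b] by (elim disjE) simp_all
        qed
        have "a \<notin> ?T" if "a \<in> A2" for a
          using dA2[OF that] dA1[OF u(1)] dA1[OF v(1)] dD[of a] by auto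
        then show "(A2 - {x,y}) \<inter> ?T = {}" by blast
      qed
    qed
    then show "\<exists>\<epsilon>. par E A2 x y \<epsilon>" by blast
  qed
  have cover: "colb E B (2 * (w * n))"
    if A: "A \<subseteq> ?L k" "stable E A" and U: "conn E U" "U \<subseteq> C" "\<And>x. x \<in> U \<Longrightarrow> k < d x" "\<And>a. a \<in> A \<Longrightarrow> \<exists>u\<in>U. E a u"
      and B: "B \<subseteq> U" "\<And>b. b \<in> B \<Longrightarrow> \<exists>a\<in>A. E a b" for A U B k
  proof (rule stable_cover_colouring[OF ohf lev finL A U(1) _ _ _ _ U(4) B])
    show "finite U" using U(2) fin finite_subset by blast
    show "U \<inter> below ?L k = {}" "A \<inter> U = {}" using U(3) A(1) by force+
    show "\<not> E x y" if "x \<in> below ?L k" "y \<in> U" for x y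
    proof -
      have "x \<in> C" "d x < k" using that(1) by auto
      moreover have "y \<in> C" "k < d y" using that(2) U by auto
      ultimately show ?thesis using bfs_nonadj[OF d, of x y] by simp
    qed
    show "clb E (A \<union> B) w" by (rule clb_subset_small[OF w(1)]) (use A(1) B(1) U(2) in auto)
    show "colb E W n" if "W \<subseteq> B" "clb E W (w - 1)" for W
      by (rule small[OF _ that(2)]) (use that(1) B(1) U(2) in auto)
  qed
  have spread: "colb E B (c * (2 * (w * n)))"
    if A: "A \<subseteq> ?L k" "colb E A c" and U: "conn E U" "U \<subseteq> C" "\<And>x. x \<in> U \<Longrightarrow> k < d x" "\<And>a. a \<in> A \<Longrightarrow> \<exists>u\<in>U. E a u"
      and B: "B \<subseteq> U" "\<And>b. b \<in> B \<Longrightarrow> \<exists>a\<in>A. E a b" for A U B k c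
  proof -
    obtain \<phi> :: "'a \<Rightarrow> nat" where \<phi>: "\<forall>x\<in>A. \<phi> x < c" "\<forall>x\<in>A. \<forall>y\<in>A. E x y \<longrightarrow> \<phi> x \<noteq> \<phi> y"
      using A(2) unfolding colb_def by blast
    \<comment> \<open>Each vertex picks some parent in \<open>A\<close>; the colour of that parent
      splits \<open>B\<close> into sets covered by stable parts of \<open>A\<close>.\<close>
    define p where "p b = (SOME a. a \<in> A \<and> E a b)" for b
    have p: "p b \<in> A" "E (p b) b" if "b \<in> B" for b
      using someI_ex[of "\<lambda>a. a \<in> A \<and> E a b"] B(2)[OF that] unfolding p_def by blast+
    show ?thesis
    proof (rule colb_fibres[of _ "\<lambda>b. \<phi> (p b)"])
      show "\<phi> (p b) < c" if "b \<in> B" for b using \<phi>(1) p(1)[OF that] by blast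
      fix e assume "e < c"
      show "colb E {b\<in>B. \<phi> (p b) = e} (2 * (w * n))"
      proof (rule cover[where A = "{a\<in>A. \<phi> a = e}" and U = U and k = k])
        have "\<not> E x y" if "x \<in> A" "\<phi> x = e" "y \<in> A" "\<phi> y = e" for x y
          using \<phi>(2)[rule_format, OF that(1,3)] that(2,4) by auto
        then show "stable E {a\<in>A. \<phi> a = e}" unfolding stable_def by simp
        show "\<exists>a\<in>{a\<in>A. \<phi> a = e}. E a b" if "b \<in> {b\<in>B. \<phi> (p b) = e}" for b using p[of b] that by auto
      qed (use A(1) U B(1) in auto)
    qed
  qed
  have col1: "colb E A1 (2 * (w - 1) * (2 * (w * n)))"
  \<comment> \<open>\<open>A1\<close> alone need not be connected, so \<open>A1 \<union> D\<close>
    serves as the set beyond \<open>A2\<close>.\<close>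
  proof (rule spread[OF A2(1) col2 conn_up[OF order_refl]])
    show "m < d x" if "x \<in> A1 \<union> D" for x using that dA1[of x] dD[of x] by auto
    show "\<exists>u\<in>A1 \<union> D. E a u" if a: "a \<in> A2" for a
    proof -
      obtain v where "v \<in> A1" "\<forall>z\<in>A2. E z v \<longleftrightarrow> z = a" using A2(3) a by blast
      then show ?thesis using a by blast
    qed
  qed (use sub A2(2) in auto)
  show ?thesis
  proof (rule spread[OF A1(1) col1 D(2) sub(1)])
    show "Suc m < d x" if "x \<in> D" for x using dD[OF that] by simp
  qed (use childA1 A1(2) in auto)
qed

text \<open>\<open>level_colouring\<close> handles depth at least two. Level 0 is one vertex, and
  level 1 lies in the neighbourhood of the root, so its clique number is at most
  \<open>w - 1\<close>. The bound is twice that of a level, by \<open>colb_bfs\<close>.\<close>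

lemma colour_step:
  assumes ohf: "odd_hole_free E" and fin: "finite W" and w: "clb E W w" "2 \<le> w" "1 \<le> n"
    and small: "\<And>U. U \<subseteq> W \<Longrightarrow> clb E U (w - 1) \<Longrightarrow> colb E U n"
  shows "colb E W (16 * w\<^sup>2 * (w - 1) * n\<^sup>2)"
proof -
  let ?K = "2 * (w - 1) * (2 * (w * n)) * (2 * (w * n))"
  have nK: "n \<le> ?K" "1 \<le> ?K"
  proof -
    have "1 \<le> 2 * (w - 1) * (2 * (w * n))" using w(2,3) by (simp add: Suc_le_eq)
    moreover have "n \<le> 2 * (w * n)" using w(2) by simp
    ultimately have "1 * n \<le> ?K" by (rule mult_le_mono)
    then show "n \<le> ?K" "1 \<le> ?K" using w(3) by linarith+
  qed
  have "colb E W (2 * ?K)"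
  proof (rule colb_bfs)
    fix C r d i D
    assume C: "C \<subseteq> W" and d: "bfs E C r d" and D: "D \<subseteq> {x\<in>C. d x = i}" "conn E D"
    have finC: "finite C" using C fin finite_subset by blast
    consider "i = 0" | "i = 1" | m where "i = Suc (Suc m)" by (metis One_nat_def not0_implies_Suc)
    then show "colb E D ?K"
    proof cases
      case 1
      then have "D \<subseteq> {r}" using D bfs_zero[OF d] by auto
      then show ?thesis using nK(2) irrefl by (intro colb_stable) auto
    next
      case 2
      have adj: "E r x" if x: "x \<in> D" for x
      proof -
        obtain y where "y \<in> C" "d y = 0" "E y x" using bfs_parent[OF d, of x 0] D(1) 2 x by auto
        then show ?thesis using bfs_zero[OF d] by auto
      qed
      have "r \<notin> D" using adj irrefl by blast
      moreover have "finite D" using D(1) finC finite_subset[of D C] by auto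
      moreover have "clb E (insert r D) w" by (rule clb_subset_small[OF w(1)]) (use D(1) C bfs_root[OF d] in auto)
      ultimately have "clb E D (w - 1)" using clb_common_neighbour[of r D w] adj by blast
      then have "colb E D n" using small[of D] D(1) C by auto
      then show ?thesis using colb_mono[OF _ order_refl nK(1)] by blast
    next
      case (3 m)
      show ?thesis
      proof (rule level_colouring[OF ohf finC d _ D(2) _ w(2)])
        show "D \<subseteq> {x\<in>C. d x = Suc (Suc m)}" using D(1) 3 by simp
        show "clb E C w" by (rule clb_subset_small[OF w(1) C])
        show "colb E U n" if "U \<subseteq> C" "clb E U (w - 1)" for U
          by (rule small[OF _ that(2)]) (use that(1) C in auto)
      qed
    qed
  qed
  moreover have "2 * ?K = 16 * w\<^sup>2 * (w - 1) * n\<^sup>2" by (simp add: power2_eq_square algebra_simps)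
  ultimately show ?thesis by (simp only:)
qed

end

section \<open>The numerical bound\<close>

fun chi_bound :: "nat \<Rightarrow> nat" where
  "chi_bound 0 = 1"
| "chi_bound (Suc 0) = 1"
| "chi_bound (Suc (Suc k)) = 16 * (k + 2)\<^sup>2 * (k + 1) * (chi_bound (Suc k))\<^sup>2"

lemma chi_bound_pos: "1 \<le> chi_bound k"
  by (induction k rule: chi_bound.induct) (auto simp: Suc_le_eq)

text \<open>The recursion of \<open>chi_bound\<close> is the count of \<open>colour_step\<close>
  with \<open>w = k + 2\<close> and \<open>n\<close> the bound for \<open>w - 1\<close>.\<close>

lemma (in sgraph) odd_hole_free_colouring:
  assumes "odd_hole_free E" "finite W" "clb E W w"
  shows "colb E W (chi_bound w)"
  using assms(2,3)
proof (induction w arbitrary: W rule: chi_bound.induct)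
  case 1
  have "x \<notin> W" for x
  proof
    assume "x \<in> W"
    then have "{x} \<subseteq> W" "clq E {x}" unfolding clq_def by auto
    then have "card {x} \<le> 0" using 1(2) unfolding clb_def by blast
    then show False by simp
  qed
  then show ?case unfolding colb_def by blast
next
  case 2
  show ?case
  proof (rule colb_stable)
    fix x y assume xy: "x \<in> W" "y \<in> W"
    show "\<not> E x y"
    proof
      assume e: "E x y"
      then have "clq E {x,y}" using sym[OF e] unfolding clq_def by auto
      then have "card {x,y} \<le> 1" using 2(2) xy unfolding clb_def by auto
      moreover have "x \<noteq> y" using e irrefl by auto
      ultimately show False by simp
    qed
  qed simp
next
  case (3 k)
  have "colb E W (16 * (k + 2)\<^sup>2 * (k + 2 - 1) * (chi_bound (Suc k))\<^sup>2)"
  proof (rule colour_step[OF assms(1) 3(2)])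
    show "clb E W (k + 2)" using 3(3) by simp
    show "1 \<le> chi_bound (Suc k)" by (rule chi_bound_pos)
    show "colb E U (chi_bound (Suc k))" if "U \<subseteq> W" "clb E U (k + 2 - 1)" for U
    proof (rule 3(1)[OF finite_subset[OF that(1) 3(2)]])
      have "k + 2 - 1 = Suc k" by simp
      then show "clb E U (Suc k)" using that(2) by (simp only:)
    qed
  qed simp
  moreover have "chi_bound (Suc (Suc k)) = 16 * (k + 2)\<^sup>2 * (k + 2 - 1) * (chi_bound (Suc k))\<^sup>2"
    by simp
  ultimately show ?case by (simp only:)
qed

text \<open>The factor \<open>16 (k + 4)\<^sup>3\<close> strengthens the induction:
  \<open>(k + 3)\<^sup>2 (k + 2) (k + 5)\<^sup>3 \<le> (k + 4)\<^sup>6\<close>.\<close>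

lemma chi_bound_aux: "chi_bound (k + 2) * (16 * (k + 4) ^ 3) \<le> 2 ^ 2 ^ (k + 4)"
proof (induction k)
  case 0
  \<comment> \<open>The base case is an equality: \<open>64 * (16 * 4 ^ 3) = 2 ^ 16\<close>.\<close>
  have "chi_bound (0 + 2) = 64" by (simp only: add_2_eq_Suc' chi_bound.simps) (simp add: power2_eq_square)
  then show ?case by simp
next
  case (Suc k)
  let ?c = "chi_bound (k + 2)"
  have 1: "(k + 3) * (k + 5) \<le> (k + 4)\<^sup>2" "(k + 2) * (k + 5) \<le> (k + 4)\<^sup>2"
    by (simp_all add: power2_eq_square algebra_simps)
  have "((k + 3) * (k + 5))\<^sup>2 * ((k + 2) * (k + 5)) \<le> ((k + 4)\<^sup>2)\<^sup>2 * (k + 4)\<^sup>2"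
    by (rule mult_le_mono[OF power_mono[OF 1(1)] 1(2)]) simp
  also have "\<dots> = ((k + 4) ^ 3)\<^sup>2" by (simp flip: power_mult power_add)
  finally have 2: "((k + 3) * (k + 5))\<^sup>2 * ((k + 2) * (k + 5)) \<le> ((k + 4) ^ 3)\<^sup>2" .
  have "chi_bound (Suc k + 2) = 16 * (k + 3)\<^sup>2 * (k + 2) * ?c\<^sup>2"
    by (simp only: add_2_eq_Suc' chi_bound.simps) (simp add: numeral_3_eq_3)
  then have "chi_bound (Suc k + 2) * (16 * (Suc k + 4) ^ 3)
      = 16\<^sup>2 * ?c\<^sup>2 * (((k + 3) * (k + 5))\<^sup>2 * ((k + 2) * (k + 5)))"
    by (simp add: power2_eq_square power3_eq_cube algebra_simps)
  also have "\<dots> \<le> 16\<^sup>2 * ?c\<^sup>2 * ((k + 4) ^ 3)\<^sup>2" by (rule mult_left_mono[OF 2]) simp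
  also have "\<dots> = (?c * (16 * (k + 4) ^ 3))\<^sup>2" by (simp add: power_mult_distrib)
  also have "\<dots> \<le> (2 ^ 2 ^ (k + 4))\<^sup>2" by (rule power_mono[OF Suc.IH]) simp
  also have "\<dots> = 2 ^ 2 ^ (Suc k + 4)"
  proof -
    have "Suc k + 4 = Suc (k + 4)" by simp
    then have "(2::nat) ^ (Suc k + 4) = 2 ^ (k + 4) * 2" by (simp only: power_Suc2)
    then show ?thesis by (simp only: power_mult)
  qed
  finally show ?case .
qed

lemma chi_bound_le: "chi_bound w \<le> 2 ^ 2 ^ (w + 2)"
proof -
  consider "w = 0" | "w = 1" | k where "w = k + 2"
    by (metis One_nat_def add_2_eq_Suc' not0_implies_Suc)
  then show ?thesis
  proof cases
    case (3 k)
    have "chi_bound (k + 2) * 1 \<le> chi_bound (k + 2) * (16 * (k + 4) ^ 3)" by (rule mult_left_mono) simp_all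
    from order_trans[OF this chi_bound_aux] have "chi_bound (k + 2) \<le> 2 ^ 2 ^ (k + 4)" by (simp only: mult_1_right)
    moreover have "w + 2 = k + 4" using 3 by simp
    ultimately show ?thesis using 3 by (simp only:)
  qed auto
qed

section \<open>Adjacency in a digraph\<close>

text \<open>Adjacency in terms of positions, the form needed for \<open>cycle_graph\<close>.\<close>

lemma ipath_nth:
  "ipath E xs \<Longrightarrow> i < j \<Longrightarrow> j < length xs \<Longrightarrow> E (xs ! i) (xs ! j) \<longleftrightarrow> j = Suc i"
proof (induction xs arbitrary: i j)
  case (Cons x xs)
  obtain j' where j: "j = Suc j'" using Cons.prems(2) by (cases j) auto
  have ne: "xs \<noteq> []" using Cons.prems(3) j by auto
  have p: "ipath E xs" "E x (hd xs)" "\<forall>z\<in>set (tl xs). \<not> E x z"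
    using Cons.prems(1) ne by (auto simp: ipath_Cons)
  show ?case
  proof (cases i)
    case (Suc i')
    then show ?thesis using Cons.IH[OF p(1), of i' j'] Cons.prems j by simp
  next
    case 0
    show ?thesis
    proof (cases j')
      case 0
      then show ?thesis using \<open>i = 0\<close> j p(2) ne by (simp add: hd_conv_nth)
    next
      case (Suc l)
      have "xs ! j' \<in> set (tl xs)" using Cons.prems(3) j Suc ne by (cases xs) auto
      then show ?thesis using \<open>i = 0\<close> j Suc p(3) by simp
    qed
  qed
qed simp

lemma adj_induce_subgraph:
  "u \<rightarrow>\<^bsub>G \<restriction> S\<^esub> v \<longleftrightarrow> u \<in> S \<and> v \<in> S \<and> u \<rightarrow>\<^bsub>G\<^esub> v"
  by (auto simp: arcs_ends_conv)

context graph begin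

lemma sgraph_adj: "sgraph (\<lambda>u v. u \<rightarrow>\<^bsub>G\<^esub> v)"
proof
  show "v \<rightarrow>\<^bsub>G\<^esub> u" if "u \<rightarrow>\<^bsub>G\<^esub> v" for u v using arcs_ends_symmetric[OF sym_arcs that] .
  show "\<not> u \<rightarrow>\<^bsub>G\<^esub> u" for u using adj_not_same by blast
qed

lemma graph_induce_subgraph:
  assumes "S \<subseteq> verts G" shows "induced_subgraph (G \<restriction> S) G" "graph (G \<restriction> S)"
proof -
  show i: "induced_subgraph (G \<restriction> S) G" using assms by (rule induced_induce)
  interpret H: digraph "G \<restriction> S" using i by (rule digraphI_induced)
  interpret H': sym_digraph "G \<restriction> S" using i by (rule induced_graph_imp_graph)
  show "graph (G \<restriction> S)" by unfold_locales
qed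

text \<open>With \<open>y\<close> at position 0 and \<open>p\<close> from position 1 on, the
  adjacent positions are the consecutive ones and the pair \<open>0\<close>,
  \<open>length p\<close>. The cycle length \<open>Suc (length p)\<close> is odd and at least
  5.\<close>

lemma odd_hole_free_adj:
  assumes "\<nexists>H. odd_hole G H"
  shows "odd_hole_free (\<lambda>u v. u \<rightarrow>\<^bsub>G\<^esub> v)"
  unfolding odd_hole_free_def
proof
  let ?E = "\<lambda>u v. u \<rightarrow>\<^bsub>G\<^esub> v"
  interpret sgraph ?E by (rule sgraph_adj)
  assume "\<exists>y p. ipath ?E p \<and> even (length p) \<and> 4 \<le> length p \<and> y \<notin> set p \<and>
    (\<forall>z\<in>set p. y \<rightarrow>\<^bsub>G\<^esub> z \<longleftrightarrow> z = hd p \<or> z = last p)"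
  then obtain y p where p: "ipath ?E p" "even (length p)" "4 \<le> length p" "y \<notin> set p"
    and y: "\<forall>z\<in>set p. y \<rightarrow>\<^bsub>G\<^esub> z \<longleftrightarrow> z = hd p \<or> z = last p" by blast
  let ?c = "\<lambda>i. (y # p) ! i" and ?n = "Suc (length p)" and ?S = "set (y # p)"
  have ne: "p \<noteq> []" using p(3) by auto
  have dp: "distinct p" using ipath_distinct[OF p(1)] .
  have dist: "distinct (y # p)" using dp p(4) by simp
  have adj: "?c i \<rightarrow>\<^bsub>G\<^esub> ?c j \<longleftrightarrow> j = Suc i \<or> (i = 0 \<and> j = length p)" if ij: "i < j" "j < ?n" for i j
  proof -
    obtain j' where j: "j = Suc j'" using ij(1) by (cases j) auto
    show ?thesis
    proof (cases i)
      case 0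
      have j': "j' < length p" using ij(2) j by simp
      have "p ! j' = hd p \<longleftrightarrow> j' = 0"
        using nth_eq_iff_index_eq[OF dp j', of 0] ne by (simp add: hd_conv_nth)
      moreover have "p ! j' = last p \<longleftrightarrow> j' = length p - 1"
        using nth_eq_iff_index_eq[OF dp j', of "length p - 1"] ne by (simp add: last_conv_nth)
      moreover have "length p - 1 = j' \<longleftrightarrow> Suc j' = length p" using ne by (cases p) auto
      ultimately show ?thesis using y j' 0 j by auto
    next
      case (Suc i')
      then show ?thesis using ipath_nth[OF p(1), of i' j'] ij j by simp
    qed
  qed
  \<comment> \<open>\<open>odd_hole_free\<close> speaks of arbitrary elements of the type; having a
    neighbour puts them into \<open>verts G\<close>.\<close>
  have sub: "?S \<subseteq> verts G"
  proof
    fix z assume "z \<in> ?S"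
    have hd: "y \<rightarrow>\<^bsub>G\<^esub> hd p" using y ne by simp
    have "\<exists>v. z \<rightarrow>\<^bsub>G\<^esub> v"
    proof (cases "z = y")
      case True then show ?thesis using hd by blast
    next
      case False
      then obtain i where i: "i < length p" "z = p ! i" using \<open>z \<in> ?S\<close> by (auto simp: in_set_conv_nth)
      show ?thesis
      proof (cases "Suc i < length p")
        case True
        then have "z \<rightarrow>\<^bsub>G\<^esub> p ! Suc i" using ipath_nth[OF p(1), of i "Suc i"] i by simp
        then show ?thesis by blast
      next
        case False
        then have "z = last p" using i ne by (simp add: last_conv_nth)
          (metis One_nat_def Suc_lessI diff_Suc_1)
        then have "y \<rightarrow>\<^bsub>G\<^esub> z" using y ne by simp
        then show ?thesis using sym by blast
      qed
    qed
    then show "z \<in> verts G" using adj_in_verts by blast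
  qed
  note H = graph_induce_subgraph[OF sub]
  have "cycle_graph ?n (G \<restriction> ?S)"
    unfolding cycle_graph_def
  proof (intro conjI exI[of _ ?c] allI impI)
    show "graph (G \<restriction> ?S)" by (rule H(2))
    show "3 \<le> ?n" using p(3) by simp
    show "bij_betw ?c {..<?n} (verts (G \<restriction> ?S))"
      using bij_betw_nth[OF dist, of "{..<?n}" ?S] by simp
    fix i j assume i: "i < ?n" and j: "j < ?n"
    have in_S: "?c i \<in> ?S" "?c j \<in> ?S" using nth_mem[of i "y # p"] nth_mem[of j "y # p"] i j by simp_all
    have "?c i \<rightarrow>\<^bsub>G\<^esub> ?c j \<longleftrightarrow> j = Suc i mod ?n \<or> i = Suc j mod ?n"
    proof (cases i j rule: linorder_cases)
      case less
      have "Suc i mod ?n = Suc i" using less j by simp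
      \<comment> \<open>Only the last position wraps around to 0.\<close>
      moreover have "i = Suc j mod ?n \<longleftrightarrow> i = 0 \<and> j = length p"
        using less j by (cases "j = length p") auto
      ultimately show ?thesis using adj[OF less j] by simp
    next
      case equal
      have "Suc i mod ?n \<noteq> i" using i p(3) by (cases "i = length p") auto
      then show ?thesis using equal irrefl by auto
    next
      case greater
      have "Suc j mod ?n = Suc j" using greater i by simp
      moreover have "j = Suc i mod ?n \<longleftrightarrow> j = 0 \<and> i = length p"
        using greater i by (cases "i = length p") auto
      ultimately show ?thesis using adj[OF greater i] symI[of "?c i"] by auto
    qed
    then show "?c i \<rightarrow>\<^bsub>G \<restriction> ?S\<^esub> ?c j \<longleftrightarrow> j = Suc i mod ?n \<or> i = Suc j mod ?n"
      using in_S unfolding adj_induce_subgraph by simp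
  qed
  then have "odd_hole G (G \<restriction> ?S)"
    unfolding odd_hole_def hole_def using p(2,3) H(1) by (intro exI[of _ ?n]) simp
  then show False using assms by blast
qed

end

theorem mainTheorem1:
  fixes G :: "('a, 'b) pre_digraph"
  assumes "graph G"
    and "\<nexists>H. odd_hole G H"
  shows "chromatic_number G \<le> 2 ^ (2 ^ (clique_number G + 2))"
proof -
  interpret graph G by fact
  let ?E = "\<lambda>u v. u \<rightarrow>\<^bsub>G\<^esub> v"
  interpret sgraph ?E by (rule sgraph_adj)
  have "clb ?E (verts G) (clique_number G)"
    unfolding clb_def
  proof (intro allI impI)
    fix K assume "K \<subseteq> verts G" "clq ?E K"
    then have "clique G K" unfolding clique_def clq_def by blast
    then show "card K \<le> clique_number G" by (rule clique_card_le)
  qed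
  then have "colb ?E (verts G) (chi_bound (clique_number G))"
    by (rule odd_hole_free_colouring[OF odd_hole_free_adj[OF assms(2)] finite_verts])
  then obtain f :: "'a \<Rightarrow> nat" where f: "\<forall>x\<in>verts G. f x < chi_bound (clique_number G)"
    "\<forall>x\<in>verts G. \<forall>y\<in>verts G. x \<rightarrow>\<^bsub>G\<^esub> y \<longrightarrow> f x \<noteq> f y" unfolding colb_def by blast
  have "proper_colouring G (chi_bound (clique_number G)) f"
    unfolding proper_colouring_def
  proof (intro conjI allI impI)
    show "f ` verts G \<subseteq> {..<chi_bound (clique_number G)}" using f(1) by auto
    show "f u \<noteq> f v" if "u \<rightarrow>\<^bsub>G\<^esub> v" for u v using f(2) that adj_in_verts[OF that] by blast
  qed
  then show ?thesis using chromatic_number_le chi_bound_le order_trans by blast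
qed

end
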